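(* For each even integer $c\ge 2$, let $\mathcal{P}_c$ be the Gauss–Legendre distribution (defined in the context) with smallest output $p_0$, and choose parameters $\eta_1=\eta_1(c)>0$, $\eta_2=\eta_2(c)>0$ and $\varepsilon_1=\varepsilon_1(c),\varepsilon_2=\varepsilon_2(c)\in(0,1)$ with $\lim_{c\to\infty}\eta_1=\eta\in(0,\infty)$, $\lim_{c\to\infty}\eta_2=\infty$, $\lim_{c\to\infty}\eta_2/c=\eta'\in[0,\infty)$, $\eta+\eta'<1$, and such that $\log(1/\varepsilon_2)/\log(1/\varepsilon_1)$ stays bounded as $c\to\infty$. Set $\mathcal{R}=\min_{1\le\ell\le c}\mathcal{R}_{\ell,\mathcal{P}_c}$, $\psi_1=\psi_2=\sigma(p_0)$, let $x_i>0$ be defined by $x_i r(x_i)=\eta_i\mathcal{R}\psi_1/c$ ($i=1,2$), let $A_i=\frac{c}{(1-\eta_1-\eta_2/c)\mathcal{R}}\cdot\frac{\psi_2}{x_i}\log\frac{1}{\varepsilon_i}$ and $m=A_1+A_2$. Then, as $c\to\infty$ through even integers, $$m\sim\frac{\pi}{(1-\eta-\eta')\,j_1\,x_\infty}\,c^2\log\frac{1}{\varepsilon_1},$$ i.e. the ratio of the two sides tends to $1$, where $x_\infty$ is the unique positive real with $x_\infty r(x_\infty)=\eta/(\pi j_1)$.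
   Context: A finite bias distribution is a probability distribution supported on a finite subset of $(0,1)$ that is symmetric (outputs $a$ and $1-a$ with equal probability); $E_p$ is expectation over its output $p$. $\sigma(p)=\sqrt{(1-p)/p}$; $f_{\ell,x}(p)=p^x(1-p)^{\ell-x}(x\sigma(p)-(\ell-x)\sigma(1-p))$; $R_{\ell,x}=\max\{0,E_p[f_{\ell,x}(p)]\}$; $\mathcal{R}_{\ell,\mathcal{P}}=E_p[-f_{\ell,0}(p)]-\sum_{x=1}^{\ell-1}\binom{\ell}{x}R_{\ell,x}$. $r(t)=(e^t-1-t)/t^2$ for $t>0$ (the map $t\mapsto t r(t)$ is a strictly increasing bijection $(0,\infty)\to(0,\infty)$). $\log$ is the natural logarithm. $j_1$ is the smallest positive zero of the Bessel function $J_0(t)=\sum_{i\ge0}(-1)^i(t/2)^{2i}/(i!)^2$. Gauss–Legendre distribution: for $c=2\nu$, let $\widetilde{L}_\nu(t)=\left.\left(\frac{d}{du}\right)^{\nu}(u^2-1)^{\nu}\right|_{u=2t-1}$; $\mathcal{P}_c$ takes as values the $\nu$ zeroes $p$ of $\widetilde L_\nu$, each with probability proportional to $\bigl((p(1-p))^{3/2}\widetilde L_\nu{}'(p)^2\bigr)^{-1}$. *)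

theory Defs
  imports "HOL-Analysis.Analysis" "HOL-Computational_Algebra.Polynomial"
begin

text \<open>Gauss--Legendre distribution for c = 2 nu.
  L~_nu(t) = ((d/du)^nu (u^2-1)^nu) at u = 2t-1, as a polynomial in t.\<close>
definition GL_poly :: "nat \<Rightarrow> real poly" where
  "GL_poly \<nu> = pcompose ((pderiv ^^ \<nu>) ([:-1, 0, 1:] ^ \<nu>)) [:-1, 2:]"

definition GL_support :: "nat \<Rightarrow> real set" where
  "GL_support \<nu> = {p. poly (GL_poly \<nu>) p = 0}"

definition GL_weight :: "nat \<Rightarrow> real \<Rightarrow> real" where
  "GL_weight \<nu> p = inverse ((p * (1 - p)) powr (3/2) * (poly (pderiv (GL_poly \<nu>)) p)^2)"

definition GL_prob :: "nat \<Rightarrow> real \<Rightarrow> real" where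
  "GL_prob \<nu> p = GL_weight \<nu> p / (\<Sum>q\<in>GL_support \<nu>. GL_weight \<nu> q)"

definition GL_E :: "nat \<Rightarrow> (real \<Rightarrow> real) \<Rightarrow> real" where
  "GL_E \<nu> g = (\<Sum>p\<in>GL_support \<nu>. GL_prob \<nu> p * g p)"

definition sigma :: "real \<Rightarrow> real" where
  "sigma p = sqrt ((1 - p) / p)"

definition f_lx :: "nat \<Rightarrow> nat \<Rightarrow> real \<Rightarrow> real" where
  "f_lx l x p = p ^ x * (1 - p) ^ (l - x) * (real x * sigma p - real (l - x) * sigma (1 - p))"

text \<open>R_{l,x} and calR_{l,P} for a distribution given by its expectation operator E.\<close>
definition R_lx :: "((real \<Rightarrow> real) \<Rightarrow> real) \<Rightarrow> nat \<Rightarrow> nat \<Rightarrow> real" where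
  "R_lx E l x = max 0 (E (f_lx l x))"

definition calR :: "((real \<Rightarrow> real) \<Rightarrow> real) \<Rightarrow> nat \<Rightarrow> real" where
  "calR E l = E (\<lambda>p. - f_lx l 0 p) - (\<Sum>x = 1..l - 1. real (l choose x) * R_lx E l x)"

definition calR_min :: "nat \<Rightarrow> real" where
  "calR_min \<nu> = Min ((\<lambda>l. calR (GL_E \<nu>) l) ` {1..2 * \<nu>})"

definition GL_p0 :: "nat \<Rightarrow> real" where
  "GL_p0 \<nu> = Min (GL_support \<nu>)"

definition r_fun :: "real \<Rightarrow> real" where
  "r_fun t = (exp t - 1 - t) / t ^ 2"

definition r_inv :: "real \<Rightarrow> real" where
  "r_inv y = (THE x. x > 0 \<and> x * r_fun x = y)"

definition J0 :: "real \<Rightarrow> real" where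
  "J0 t = (\<Sum>i. (-1) ^ i * (t / 2) ^ (2 * i) / (fact i) ^ 2)"

definition j1 :: real where
  "j1 = (THE t. t > 0 \<and> J0 t = 0 \<and> (\<forall>s. 0 < s \<and> s < t \<longrightarrow> J0 s \<noteq> 0))"

definition A_i :: "(nat \<Rightarrow> real) \<Rightarrow> (nat \<Rightarrow> real) \<Rightarrow> real \<Rightarrow> real \<Rightarrow> nat \<Rightarrow> real" where
  "A_i \<eta>1 \<eta>2 \<eta>i \<epsilon>i \<nu> =
     (let c = real (2 * \<nu>); R = calR_min \<nu>; \<psi> = sigma (GL_p0 \<nu>);
          x = r_inv (\<eta>i * R * \<psi> / c)
      in c / ((1 - \<eta>1 \<nu> - \<eta>2 \<nu> / c) * R) * (\<psi> / x) * ln (1 / \<epsilon>i))"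

definition m_GL :: "(nat \<Rightarrow> real) \<Rightarrow> (nat \<Rightarrow> real) \<Rightarrow> (nat \<Rightarrow> real) \<Rightarrow> (nat \<Rightarrow> real) \<Rightarrow> nat \<Rightarrow> real" where
  "m_GL \<eta>1 \<eta>2 \<epsilon>1 \<epsilon>2 \<nu> =
     A_i \<eta>1 \<eta>2 (\<eta>1 \<nu>) (\<epsilon>1 \<nu>) \<nu> + A_i \<eta>1 \<eta>2 (\<eta>2 \<nu>) (\<epsilon>2 \<nu>) \<nu>"

end

theory Submission
  imports Defs
begin

text \<open>
  Since \<open>f\<^bsub>l,x\<^esub>(p) = sqrt (p (1 - p)) * (p ^ x (1 - p) ^ (l - x))'\<close> and the probabilities are
  \<open>w\<^sub>p / sqrt (p (1 - p))\<close> up to normalisation, with \<open>w\<^sub>p\<close> the Gauss--Legendre weights on \<open>[0, 1]\<close>,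
  exactness of the quadrature in degree below \<open>2 \<nu>\<close> makes every \<open>calR\<close> with \<open>1 \<le> l \<le> 2 \<nu>\<close> equal to
  \<open>1 / S\<close>, where \<open>S = \<Sum>\<^sub>p w\<^sub>p / sqrt (p (1 - p))\<close>. Expanding \<open>(1 - u\<^sup>2) powr (-1/2)\<close>, \<open>u = 2 p - 1\<close>,
  into its power series with nonnegative coefficients, the quadrature is exact on the first \<open>\<nu>\<close> even
  powers and underestimates the others, so \<open>S\<close> tends to \<open>\<integral> (t (1 - t)) powr (-1/2) dt = \<pi>\<close>.
  After rescaling by \<open>\<nu> (\<nu> + 1)\<close> the Legendre polynomials converge locally uniformly to
  \<open>J0 (2 sqrt y)\<close> (Mehler), whose first zero is a sign change, so \<open>\<sigma>(p\<^sub>0) / c\<close> tends to \<open>1 / j1\<close>.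
  Thus \<open>x\<^sub>1\<close> converges, \<open>x\<^sub>2\<close> diverges, and \<open>A\<^sub>2\<close> is negligible against \<open>A\<^sub>1\<close>.
\<close>

section \<open>Integrals and roots of real polynomials\<close>

text \<open>A functional on polynomials rather than on functions: linearity, integration by parts
  and orthogonality become identities in the polynomial ring, free of integrability side
  conditions.\<close>

definition unit_integral :: "real poly \<Rightarrow> real" where
  "unit_integral p = integral {0..1} (poly p)"

lemma poly_integrable_on_interval: "(poly p) integrable_on {a..b::real}"
  by (intro integrable_continuous_real continuous_intros)

lemma unit_integral_add: "unit_integral (p + q) = unit_integral p + unit_integral q"
proof -
  have "poly (p + q) = (\<lambda>x. poly p x + poly q x)" by auto
  thus ?thesis
    unfolding unit_integral_def by (simp add: integral_add poly_integrable_on_interval)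
qed

lemma unit_integral_smult: "unit_integral (smult a p) = a * unit_integral p"
proof -
  have "poly (smult a p) = (\<lambda>x. a * poly p x)" by auto
  thus ?thesis unfolding unit_integral_def by simp
qed

lemma unit_integral_0 [simp]: "unit_integral 0 = 0"
  using unit_integral_smult[of 0 0] by simp

lemma unit_integral_diff: "unit_integral (p - q) = unit_integral p - unit_integral q"
  using unit_integral_add[of "p - q" q] by simp

lemma unit_integral_minus: "unit_integral (- p) = - unit_integral p"
  using unit_integral_diff[of 0 p] by simp

lemma unit_integral_sum: "unit_integral (sum f A) = (\<Sum>a\<in>A. unit_integral (f a))"
  by (induction A rule: infinite_finite_induct) (auto simp: unit_integral_add)

lemma unit_integral_pderiv: "unit_integral (pderiv p) = poly p 1 - poly p 0"
proof -
  have "(poly (pderiv p) has_integral (poly p 1 - poly p 0)) {0..1}"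
    by (intro fundamental_theorem_of_calculus)
       (auto intro!: has_field_derivative_at_within poly_DERIV
             simp flip: has_real_derivative_iff_has_vector_derivative)
  thus ?thesis unfolding unit_integral_def by (rule integral_unique)
qed

lemma unit_integral_nonneg:
  assumes "\<And>x. x \<in> {0..1} \<Longrightarrow> poly p x \<ge> 0"
  shows "unit_integral p \<ge> 0"
  unfolding unit_integral_def using assms by (intro integral_nonneg poly_integrable_on_interval) auto

text \<open>A continuous nonnegative function with zero integral vanishes on all of [0, 1], which is
  too many roots for a nonzero polynomial.\<close>

lemma unit_integral_square_pos:
  assumes "p \<noteq> 0"
  shows "unit_integral (p * p) > 0"
proof (rule ccontr)
  assume "\<not> ?thesis"
  moreover have "unit_integral (p * p) \<ge> 0" by (rule unit_integral_nonneg) simp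
  ultimately have "integral {0..1} (poly (p * p)) = 0"
    unfolding unit_integral_def by simp
  moreover have "(integral {0..1} (poly (p * p)) = 0) =
      (\<forall>x\<in>{0..1}. poly (p * p) x = 0)"
    by (rule integral_eq_0_iff) (auto intro!: continuous_intros)
  ultimately have "{0..1} \<subseteq> {x. poly p x = 0}" by auto
  hence "finite {0..1::real}" using poly_roots_finite[OF assms] finite_subset by blast
  thus False using infinite_Icc[of 0 "1::real"] by simp
qed

lemma unit_integral_by_parts:
  "unit_integral (pderiv p * q) =
     poly p 1 * poly q 1 - poly p 0 * poly q 0 - unit_integral (p * pderiv q)"
proof -
  have "pderiv (p * q) = p * pderiv q + pderiv p * q" by (simp add: pderiv_mult)
  from arg_cong[OF this, of unit_integral] show ?thesis
    by (simp only: unit_integral_add unit_integral_pderiv poly_mult)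
qed

lemma pderiv_eq_exists: "\<exists>q :: real poly. pderiv q = p"
proof -
  define q where "q = (\<Sum>i\<le>degree p. monom (coeff p i / real (Suc i)) (Suc i))"
  have "pderiv q = (\<Sum>i\<le>degree p. monom (coeff p i) i)"
    unfolding q_def higher_pderiv_sum[of 1, simplified]
    by (intro sum.cong) (simp_all add: pderiv_monom del: of_nat_Suc)
  thus ?thesis using poly_as_sum_of_monoms[of p] by metis
qed

text \<open>Induction on the largest root: the mean value theorem gives a critical point to the
  right of \<open>Max A\<close>, while the earlier ones lie strictly to its left, so it is not among
  them.\<close>

lemma Rolle_poly_roots:
  fixes p :: "real poly"
  assumes "finite S" "S \<noteq> {}" "\<And>x. x \<in> S \<Longrightarrow> poly p x = 0"
  shows "\<exists>T. finite T \<and> card T + 1 = card S \<and> T \<subseteq> {Min S<..<Max S} \<and>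
             (\<forall>x\<in>T. poly (pderiv p) x = 0)"
  using assms
proof (induction S rule: finite_linorder_max_induct)
  case empty
  thus ?case by simp
next
  case (insert b A)
  show ?case
  proof (cases "A = {}")
    case True
    thus ?thesis by (intro exI[of _ "{}"]) auto
  next
    case False
    with insert obtain T where T: "finite T" "card T + 1 = card A" "T \<subseteq> {Min A<..<Max A}"
      "\<forall>x\<in>T. poly (pderiv p) x = 0"
      by auto
    have "Max A < b" "poly p (Max A) = 0" using insert False by auto
    with poly_MVT[of "Max A" b p] insert.prems obtain x
      where x: "Max A < x" "x < b" "poly (pderiv p) x = 0" by auto
    have "Min A \<le> Max A" using False insert.hyps by simp
    have ext: "Min (insert b A) = Min A" "Max (insert b A) = b"
      using False insert.hyps \<open>Min A \<le> Max A\<close> \<open>Max A < b\<close>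
      by (force simp: min_def, intro Max_eqI) (auto intro: less_imp_le)
    have "card (insert x T) + 1 = card (insert b A)"
      using T x insert.hyps by (subst (1 2) card_insert_disjoint) auto
    moreover have "insert x T \<subseteq> {Min (insert b A)<..<Max (insert b A)}"
      unfolding ext using T(3) x \<open>Min A \<le> Max A\<close> \<open>Max A < b\<close> by fastforce
    ultimately show ?thesis using T(1,4) x(3) by (intro exI[of _ "insert x T"]) auto
  qed
qed

lemma pcompose_power: "pcompose (p ^ n) q = pcompose p q ^ n"
  for p q :: "'a::comm_semiring_1 poly"
  by (induction n) (simp_all add: pcompose_mult pcompose_1)

lemma power_dvd_pderiv:
  fixes p q :: "real poly"
  assumes "q ^ Suc n dvd p"
  shows "q ^ n dvd pderiv p"
proof -
  from assms obtain r where r: "p = q ^ Suc n * r" by auto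
  show ?thesis unfolding r pderiv_mult pderiv_power_Suc
    by (intro dvd_add) (simp_all add: dvd_smult)
qed

section \<open>Shifted Legendre polynomials\<close>

text \<open>Under u = 2t - 1 the polynomial u^2 - 1 becomes -4t(1 - t), and each derivative in t
  produces a factor 2; hence the constant (-4)^\<nu> / 2^\<nu>.\<close>

lemma GL_poly_Rodrigues:
  "GL_poly \<nu> = smult ((-2) ^ \<nu>) ((pderiv ^^ \<nu>) ([:0, 1, -1:] ^ \<nu>))"
proof -
  have scale: "(pderiv ^^ n) (pcompose p [:-1, 2:]) = smult (2 ^ n) (pcompose ((pderiv ^^ n) p) [:-1, 2:])"
    for n and p :: "real poly"
    by (induction n) (simp_all add: pderiv_smult pderiv_pcompose pderiv_pCons mult.commute)
  have "pcompose [:-1, 0, 1:] [:-1, 2:] = smult (-4) [:0, 1, -1 :: real:]"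
    by (simp add: pcompose_pCons)
  hence "pcompose ([:-1, 0, 1:] ^ \<nu>) [:-1, 2:] = smult ((-4) ^ \<nu>) ([:0, 1, -1 :: real:] ^ \<nu>)"
    by (simp only: pcompose_power smult_power)
  with scale[of \<nu> "[:-1, 0, 1:] ^ \<nu>"]
  have "smult (2 ^ \<nu>) (GL_poly \<nu>) = smult ((-4) ^ \<nu>) ((pderiv ^^ \<nu>) ([:0, 1, -1:] ^ \<nu>))"
    unfolding GL_poly_def by (simp add: higher_pderiv_smult)
  hence "smult (inverse (2 ^ \<nu>)) (smult (2 ^ \<nu>) (GL_poly \<nu>)) =
     smult (inverse (2 ^ \<nu>)) (smult ((-4) ^ \<nu>) ((pderiv ^^ \<nu>) ([:0, 1, -1:] ^ \<nu>)))"
    by simp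
  moreover have "inverse (2 ^ \<nu>) * (-4) ^ \<nu> = (-2 :: real) ^ \<nu>"
    by (simp add: divide_simps flip: power_mult_distrib)
  ultimately show ?thesis by simp
qed

lemma coeff_GL_poly:
  "coeff (GL_poly \<nu>) k = (-2) ^ \<nu> * ((-1) ^ k * real (\<nu> choose k) * (fact (\<nu> + k) / fact k))"
proof -
  have "[:0, 1, -1:] = monom 1 1 * [:1, -1 :: real:]" by (simp add: monom_altdef)
  hence "[:0, 1, -1:] ^ \<nu> = monom 1 \<nu> * [:1, -1 :: real:] ^ \<nu>"
    by (simp only: power_mult_distrib monom_power) simp
  hence "coeff ([:0, 1, -1 :: real:] ^ \<nu>) (k + \<nu>) = (-1) ^ k * real (\<nu> choose k)"
    using coeff_linear_poly_power[of k \<nu> 1 "-1 :: real"]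
    by (cases "k \<le> \<nu>") (simp_all add: coeff_monom_mult coeff_eq_0 degree_linear_power binomial_eq_0)
  moreover have "pochhammer (real (Suc k)) \<nu> = fact (\<nu> + k) / fact k"
    using pochhammer_product'[of "1 :: real" k \<nu>]
    by (simp add: add.commute eq_divide_eq mult.commute flip: pochhammer_fact)
  ultimately show ?thesis by (simp add: GL_poly_Rodrigues coeff_higher_pderiv)
qed

lemma degree_GL_poly [simp]: "degree (GL_poly \<nu>) = \<nu>"
  by (rule antisym; (rule degree_le | rule le_degree)) (auto simp: coeff_GL_poly)

lemma GL_poly_nonzero [simp]: "GL_poly \<nu> \<noteq> 0"
  using coeff_GL_poly[of \<nu> 0] by auto

text \<open>Both Legendre's equation and the comparison with the Bessel series are read off from
  this ratio of consecutive coefficients.\<close>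

lemma coeff_GL_poly_Suc:
  "real (Suc k) ^ 2 * coeff (GL_poly \<nu>) (Suc k) =
     - (real \<nu> - real k) * (real \<nu> + real k + 1) * coeff (GL_poly \<nu>) k"
proof -
  have 1: "real (Suc k) * real (\<nu> choose Suc k) = (real \<nu> - real k) * real (\<nu> choose k)"
  proof (cases "k \<le> \<nu>")
    case True
    thus ?thesis using binomial_absorb_comp[of \<nu> k] binomial_absorption[of k \<nu>]
      by (metis of_nat_diff of_nat_mult)
  qed (simp add: binomial_eq_0)
  have 2: "real (Suc k) * (fact (\<nu> + Suc k) / fact (Suc k)) = (real \<nu> + real k + 1) * (fact (\<nu> + k) / fact k)"
    by (simp add: divide_simps)
  have "real (Suc k) ^ 2 * coeff (GL_poly \<nu>) (Suc k) = (-2) ^ \<nu> * (-1) ^ Suc k *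
      (real (Suc k) * real (\<nu> choose Suc k)) * (real (Suc k) * (fact (\<nu> + Suc k) / fact (Suc k)))"
    unfolding coeff_GL_poly by (simp only: power2_eq_square mult_ac)
  also have "\<dots> = - (real \<nu> - real k) * (real \<nu> + real k + 1) * coeff (GL_poly \<nu>) k"
    unfolding 1 2 coeff_GL_poly by (simp add: field_simps)
  finally show ?thesis .
qed

text \<open>Legendre's equation on [0, 1], in the self-adjoint form that suits integration by parts.
  Coefficientwise it is the preceding recurrence.\<close>

lemma GL_poly_ODE:
  "pderiv ([:0, 1, -1:] * pderiv (GL_poly \<nu>)) = smult (- (real \<nu> * (real \<nu> + 1))) (GL_poly \<nu>)"
proof (rule poly_eqI)
  fix k
  let ?c = "coeff (GL_poly \<nu>)"
  have "coeff ([:0, 1, -1:] * pderiv (GL_poly \<nu>)) (Suc k) = real (Suc k) * ?c (Suc k) - real k * ?c k"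
    by (cases k) (simp_all add: coeff_pderiv coeff_pCons)
  hence "coeff (pderiv ([:0, 1, -1:] * pderiv (GL_poly \<nu>))) k =
      real (Suc k) ^ 2 * ?c (Suc k) - real (Suc k) * real k * ?c k"
    by (simp add: coeff_pderiv[of "_ * _"] power2_eq_square right_diff_distrib mult.assoc del: mult_pCons_left of_nat_Suc)
  also have "\<dots> = - (real \<nu> * (real \<nu> + 1)) * ?c k"
    unfolding coeff_GL_poly_Suc by (simp add: algebra_simps)
  finally show "coeff (pderiv ([:0, 1, -1:] * pderiv (GL_poly \<nu>))) k =
      coeff (smult (- (real \<nu> * (real \<nu> + 1))) (GL_poly \<nu>)) k" by simp
qed

section \<open>Orthogonality and zeros of the Legendre polynomials\<close>

lemma power_dvd_higher_pderiv:
  fixes q :: "real poly"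
  assumes "j \<le> n"
  shows "q ^ (n - j) dvd (pderiv ^^ j) (q ^ n)"
  using assms
proof (induction j)
  case (Suc j)
  hence "q ^ Suc (n - Suc j) dvd (pderiv ^^ j) (q ^ n)" by (simp add: Suc_diff_Suc del: power_Suc)
  thus ?case using power_dvd_pderiv by simp
qed simp

text \<open>Fewer than \<nu> derivatives leave a factor t(1 - t). This removes the boundary terms in
  integrations by parts and supplies 0 and 1 as extra roots for Rolle's theorem.\<close>

lemma higher_pderiv_endpoints:
  assumes "j < \<nu>"
  shows "poly ((pderiv ^^ j) ([:0, 1, -1 :: real:] ^ \<nu>)) 0 = 0"
    and "poly ((pderiv ^^ j) ([:0, 1, -1 :: real:] ^ \<nu>)) 1 = 0"
proof -
  obtain r where "(pderiv ^^ j) ([:0, 1, -1 :: real:] ^ \<nu>) = [:0, 1, -1:] ^ (\<nu> - j) * r"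
    using power_dvd_higher_pderiv[of j \<nu> "[:0, 1, -1 :: real:]"] assms by auto
  thus "poly ((pderiv ^^ j) ([:0, 1, -1 :: real:] ^ \<nu>)) 0 = 0"
    and "poly ((pderiv ^^ j) ([:0, 1, -1 :: real:] ^ \<nu>)) 1 = 0"
    using assms by (simp_all add: poly_power)
qed

text \<open>Integrating by parts \<nu> times moves every derivative of the Rodrigues form onto
  \<open>g\<close>, whose degree is too small to survive.\<close>

lemma GL_poly_orthogonal:
  assumes "degree g < \<nu>"
  shows "unit_integral (GL_poly \<nu> * g) = 0"
proof -
  let ?h = "[:0, 1, -1 :: real:] ^ \<nu>"
  have "unit_integral ((pderiv ^^ j) ?h * g) = (-1) ^ j * unit_integral (?h * (pderiv ^^ j) g)"
    if "j \<le> \<nu>" for j g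
    using that
  proof (induction j arbitrary: g)
    case (Suc j)
    have "unit_integral ((pderiv ^^ Suc j) ?h * g) = - unit_integral ((pderiv ^^ j) ?h * pderiv g)"
      using Suc.prems unit_integral_by_parts[of "(pderiv ^^ j) ?h" g]
      by (simp add: higher_pderiv_endpoints)
    also have "\<dots> = (-1) ^ Suc j * unit_integral (?h * (pderiv ^^ Suc j) g)"
      using Suc.IH[of "pderiv g"] Suc.prems by (simp add: funpow_swap1)
    finally show ?case .
  qed simp
  from this[of \<nu> g] have "unit_integral ((pderiv ^^ \<nu>) ?h * g) =
      (-1) ^ \<nu> * unit_integral (?h * (pderiv ^^ \<nu>) g)" by simp
  moreover have "(pderiv ^^ \<nu>) g = 0"
    using assms by (intro poly_eqI) (simp add: coeff_higher_pderiv coeff_eq_0)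
  ultimately show ?thesis by (simp add: GL_poly_Rodrigues unit_integral_smult)
qed

lemma GL_support_finite [simp]: "finite (GL_support \<nu>)"
  unfolding GL_support_def by (rule poly_roots_finite) simp

text \<open>Together with 0 and 1 the \<open>j\<close> interior roots make \<open>j + 2\<close>
  points, so Rolle's theorem gives \<open>j + 1\<close> interior roots of the next
  derivative.\<close>

lemma higher_pderiv_roots:
  assumes "j \<le> \<nu>"
  shows "\<exists>T. finite T \<and> card T = j \<and> T \<subseteq> {0<..<1} \<and>
             (\<forall>x\<in>T. poly ((pderiv ^^ j) ([:0, 1, -1 :: real:] ^ \<nu>)) x = 0)"
  using assms
proof (induction j)
  case 0
  show ?case by (rule exI[of _ "{}"]) simp
next
  case (Suc j)
  then obtain T where T: "finite T" "card T = j" "T \<subseteq> {0<..<1}"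
    "\<forall>x\<in>T. poly ((pderiv ^^ j) ([:0, 1, -1 :: real:] ^ \<nu>)) x = 0" by auto
  let ?S = "insert 0 (insert 1 T)"
  have "0 \<notin> T" "1 \<notin> T" using T by auto
  hence card: "card ?S = j + 2" using T by simp
  have "Min ?S = 0" using T by (intro Min_eqI) auto
  moreover have "Max ?S = 1" using T by (intro Max_eqI) auto
  moreover have "\<exists>T'. finite T' \<and> card T' + 1 = card ?S \<and> T' \<subseteq> {Min ?S<..<Max ?S} \<and>
      (\<forall>x\<in>T'. poly (pderiv ((pderiv ^^ j) ([:0, 1, -1 :: real:] ^ \<nu>))) x = 0)"
    using T Suc.prems by (intro Rolle_poly_roots) (auto simp: higher_pderiv_endpoints)
  ultimately show ?case using card by auto
qed

text \<open>Rolle's theorem yields \<nu> roots inside (0, 1), and the degree allows no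
  others.\<close>

lemma GL_support_card: "card (GL_support \<nu>) = \<nu>"
  and GL_support_subset: "GL_support \<nu> \<subseteq> {0<..<1}"
proof -
  obtain T where T: "finite T" "card T = \<nu>" "T \<subseteq> {0<..<1}"
    "\<forall>x\<in>T. poly ((pderiv ^^ \<nu>) ([:0, 1, -1 :: real:] ^ \<nu>)) x = 0"
    using higher_pderiv_roots[of \<nu> \<nu>] by auto
  hence "T \<subseteq> GL_support \<nu>" by (auto simp: GL_support_def GL_poly_Rodrigues)
  moreover have "card (GL_support \<nu>) \<le> \<nu>"
    using card_poly_roots_bound[of "GL_poly \<nu>"] by (simp add: GL_support_def)
  ultimately have "T = GL_support \<nu>" using T by (intro card_seteq) auto
  thus "card (GL_support \<nu>) = \<nu>" "GL_support \<nu> \<subseteq> {0<..<1}" using T by auto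
qed

lemma GL_support_reflect: "p \<in> GL_support \<nu> \<longleftrightarrow> 1 - p \<in> GL_support \<nu>"
proof -
  have refl: "(pderiv ^^ n) (pcompose p [:1, -1:]) = smult ((-1) ^ n) (pcompose ((pderiv ^^ n) p) [:1, -1:])"
    for n and p :: "real poly"
    by (induction n) (simp_all add: pderiv_smult pderiv_pcompose pderiv_pCons)
  have "pcompose ([:0, 1, -1:] ^ \<nu>) [:1, -1:] = [:0, 1, -1 :: real:] ^ \<nu>"
    by (simp add: pcompose_power pcompose_pCons)
  with refl[of \<nu> "[:0, 1, -1:] ^ \<nu>"]
  have "poly ((pderiv ^^ \<nu>) ([:0, 1, -1:] ^ \<nu>)) p = (-1) ^ \<nu> * poly ((pderiv ^^ \<nu>) ([:0, 1, -1:] ^ \<nu>)) (1 - p)"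
    by (metis (no_types, lifting) poly_pcompose poly_smult poly_pCons poly_0 add.right_neutral mult_zero_right mult_minus1_right add_uminus_conv_diff mult.right_neutral)
  thus ?thesis by (simp add: GL_support_def GL_poly_Rodrigues)
qed

section \<open>Gauss--Legendre quadrature\<close>

text \<open>At a root \<open>p\<close> synthetic division is exact, so this is the Lagrange basis
  polynomial of the node \<open>p\<close> before normalisation.\<close>

definition GL_cofactor :: "nat \<Rightarrow> real \<Rightarrow> real poly" where
  "GL_cofactor \<nu> p = synthetic_div (GL_poly \<nu>) p"

text \<open>The Christoffel number in interpolatory form: the integral of the normalised Lagrange
  basis polynomial.\<close>

definition quad_weight :: "nat \<Rightarrow> real \<Rightarrow> real" where
  "quad_weight \<nu> p = unit_integral (GL_cofactor \<nu> p) / poly (GL_cofactor \<nu> p) p"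

context
  fixes \<nu> :: nat and p :: real
  assumes p: "p \<in> GL_support \<nu>"
begin

lemma GL_poly_eq_cofactor: "GL_poly \<nu> = [:-p, 1:] * GL_cofactor \<nu> p"
  using synthetic_div_correct'[of p "GL_poly \<nu>"] p
  by (simp add: GL_support_def GL_cofactor_def)

lemma pos_of_GL_support: "\<nu> > 0"
  using p GL_support_card[of \<nu>] by (auto intro!: Nat.gr0I)

lemma degree_GL_cofactor: "degree (GL_cofactor \<nu> p) = \<nu> - 1"
  by (simp add: GL_cofactor_def degree_synthetic_div)

lemma GL_cofactor_nonzero: "GL_cofactor \<nu> p \<noteq> 0"
  using GL_poly_eq_cofactor GL_poly_nonzero[of \<nu>] by auto

lemma poly_GL_cofactor_other:
  "q \<in> GL_support \<nu> \<Longrightarrow> q \<noteq> p \<Longrightarrow> poly (GL_cofactor \<nu> p) q = 0"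
  using arg_cong[OF GL_poly_eq_cofactor, of "\<lambda>f. poly f q"] by (auto simp: GL_support_def)

text \<open>Simplicity of the nodes: otherwise the cofactor, of degree \<nu> - 1, would vanish at
  all \<nu> of them.\<close>

lemma poly_GL_cofactor_self: "poly (GL_cofactor \<nu> p) p \<noteq> 0"
proof
  assume "poly (GL_cofactor \<nu> p) p = 0"
  hence "GL_support \<nu> \<subseteq> {x. poly (GL_cofactor \<nu> p) x = 0}"
    using poly_GL_cofactor_other by blast
  hence "card (GL_support \<nu>) \<le> card {x. poly (GL_cofactor \<nu> p) x = 0}"
    by (intro card_mono poly_roots_finite GL_cofactor_nonzero)
  also have "\<dots> \<le> \<nu> - 1"
    using card_poly_roots_bound[OF GL_cofactor_nonzero] by (simp add: degree_GL_cofactor)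
  finally show False using pos_of_GL_support by (simp add: GL_support_card)
qed

lemma pderiv_GL_poly_root: "poly (pderiv (GL_poly \<nu>)) p = poly (GL_cofactor \<nu> p) p"
  by (subst GL_poly_eq_cofactor, subst pderiv_mult) (simp add: pderiv_pCons)

end

lemma interpolation_GL_support:
  assumes "degree g < \<nu>"
  shows "g = (\<Sum>p\<in>GL_support \<nu>. smult (poly g p / poly (GL_cofactor \<nu> p) p) (GL_cofactor \<nu> p))"
    (is "g = ?S")
proof (rule poly_eqI_degree[of "GL_support \<nu>"])
  fix x assume x: "x \<in> GL_support \<nu>"
  have "poly ?S x = (\<Sum>p\<in>{x}. poly g p / poly (GL_cofactor \<nu> p) p * poly (GL_cofactor \<nu> p) x)"
    unfolding poly_sum poly_smult using x
    by (intro sum.mono_neutral_right) (auto simp: poly_GL_cofactor_other)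
  thus "poly g x = poly ?S x" using poly_GL_cofactor_self[OF x] by simp
next
  show "degree g < card (GL_support \<nu>)" using assms by (simp add: GL_support_card)
  have "degree ?S \<le> \<nu> - 1"
    by (intro degree_sum_le) (auto intro: order.trans[OF degree_smult_le] simp: degree_GL_cofactor)
  thus "degree ?S < card (GL_support \<nu>)" using assms by (simp add: GL_support_card)
qed

text \<open>Divide \<open>g\<close> by the Legendre polynomial. The quotient has degree below \<nu>
  and drops out by orthogonality; the remainder agrees with \<open>g\<close> at the nodes and is
  reproduced by interpolation.\<close>

lemma Gauss_quadrature:
  assumes "degree g < 2 * \<nu>"
  shows "unit_integral g = (\<Sum>p\<in>GL_support \<nu>. quad_weight \<nu> p * poly g p)"
proof -
  let ?L = "GL_poly \<nu>"
  define a b where "a = g div ?L" and "b = g mod ?L"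
  have g: "g = ?L * a + b" by (simp add: a_def b_def)
  have b: "degree b < \<nu>"
    using degree_mod_less[of ?L g] assms by (auto simp: b_def)
  have a: "degree a < \<nu>"
  proof (cases "a = 0")
    case False
    hence "\<nu> + degree a = degree (g - b)" by (simp add: g degree_mult_eq)
    also have "\<dots> < 2 * \<nu>" using b assms by (intro degree_diff_less) auto
    finally show ?thesis by simp
  qed (use b in simp)
  have "unit_integral g = unit_integral b"
    using GL_poly_orthogonal[OF a] by (subst g) (simp add: unit_integral_add)
  also have "\<dots> = (\<Sum>p\<in>GL_support \<nu>. quad_weight \<nu> p * poly b p)"
    by (subst interpolation_GL_support[OF b])
       (simp add: unit_integral_sum unit_integral_smult quad_weight_def mult_ac)
  also have "\<dots> = (\<Sum>p\<in>GL_support \<nu>. quad_weight \<nu> p * poly g p)"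
    by (intro sum.cong) (auto simp: g GL_support_def)
  finally show ?thesis .
qed

section \<open>Closed form of the quadrature weights\<close>

context
  fixes \<nu> :: nat and p :: real
  assumes p: "p \<in> GL_support \<nu>"
begin

text \<open>The squared cofactor has degree at most 2\<nu> - 2, so the quadrature is exact on it,
  and only the node \<open>p\<close> contributes. Positivity of the weight follows.\<close>

lemma quad_weight_eq_square:
  "quad_weight \<nu> p =
     unit_integral (GL_cofactor \<nu> p * GL_cofactor \<nu> p) / (poly (GL_cofactor \<nu> p) p)\<^sup>2"
proof -
  let ?M = "GL_cofactor \<nu> p"
  have "degree (?M * ?M) < 2 * \<nu>"
    using pos_of_GL_support[OF p] degree_mult_le[of ?M ?M] by (simp add: degree_GL_cofactor[OF p])
  hence "unit_integral (?M * ?M) = (\<Sum>q\<in>GL_support \<nu>. quad_weight \<nu> q * poly (?M * ?M) q)"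
    by (rule Gauss_quadrature)
  also have "\<dots> = (\<Sum>q\<in>{p}. quad_weight \<nu> q * poly (?M * ?M) q)"
    using p by (intro sum.mono_neutral_right) (auto simp: poly_GL_cofactor_other[OF p])
  finally show ?thesis using poly_GL_cofactor_self[OF p] by (simp add: power2_eq_square)
qed

lemma quad_weight_pos: "quad_weight \<nu> p > 0"
  unfolding quad_weight_eq_square
  using unit_integral_square_pos[OF GL_cofactor_nonzero[OF p]] poly_GL_cofactor_self[OF p] by simp

text \<open>Subtracting a multiple of the Legendre polynomial lowers the degree below \<nu>, and
  what remains is orthogonal.\<close>

lemma unit_integral_GL_poly_mult:
  assumes "degree g \<le> \<nu>"
  shows "unit_integral (GL_poly \<nu> * g) =
           coeff g \<nu> / lead_coeff (GL_poly \<nu>) * unit_integral (GL_poly \<nu> * GL_poly \<nu>)"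
proof -
  let ?L = "GL_poly \<nu>" and ?a = "coeff g \<nu> / lead_coeff (GL_poly \<nu>)"
  define h where "h = g - smult ?a ?L"
  have "lead_coeff ?L \<noteq> 0" by (simp only: leading_coeff_0_iff GL_poly_nonzero not_False_eq_True)
  hence "coeff h \<nu> = 0" by (simp add: h_def)
  moreover have "degree h \<le> \<nu>"
    unfolding h_def using assms by (intro degree_diff_le) (auto intro: order.trans[OF degree_smult_le])
  ultimately have "degree h < \<nu>"
    using pos_of_GL_support[OF p] by (metis degree_0 le_neq_implies_less leading_coeff_0_iff)
  hence "unit_integral (?L * h) = 0" by (rule GL_poly_orthogonal)
  moreover have "?L * g = ?L * h + smult ?a (?L * ?L)" by (simp add: h_def algebra_simps)
  ultimately show ?thesis by (simp add: unit_integral_add unit_integral_smult)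
qed

text \<open>With \<open>q = t (1 - t)\<close> and \<open>L = (t - p) M\<close>, both \<open>q(p) M\<^sup>2 = q M\<^sup>2 - (1 - t - p) L M\<close> and
  \<open>(q L M)' = q' L M + 2 q L' M - q M\<^sup>2\<close>; the remaining integrals only see leading coefficients,
  by orthogonality and the differential equation \<open>(q L')' = - \<nu> (\<nu> + 1) L\<close>.\<close>
lemma unit_integral_cofactor_square:
  "p * (1 - p) * unit_integral (GL_cofactor \<nu> p * GL_cofactor \<nu> p) =
     (2 * real \<nu> + 1) * unit_integral (GL_poly \<nu> * GL_poly \<nu>)"
proof -
  let ?L = "GL_poly \<nu>" and ?M = "GL_cofactor \<nu> p" and ?q = "[:0, 1, -1 :: real:]"
  let ?a = "lead_coeff ?L" and ?N = "unit_integral (?L * ?L)"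
  note L = GL_poly_eq_cofactor[OF p] and degM = degree_GL_cofactor[OF p]
  obtain m where \<nu>: "\<nu> = Suc m" using pos_of_GL_support[OF p] by (cases \<nu>) auto
  have a0: "?a \<noteq> 0" by (simp only: leading_coeff_0_iff GL_poly_nonzero not_False_eq_True)
  have M\<nu>: "coeff ?M \<nu> = 0" using degM \<nu> by (intro coeff_eq_0) simp
  have Mm: "coeff ?M m = ?a"
    using arg_cong[OF L, of "\<lambda>f. coeff f \<nu>"] M\<nu> by (simp add: \<nu>)
  have LM: "unit_integral (?L * ([:b, c:] * ?M)) = c * ?N" for b c
  proof -
    have "degree ([:b, c:] * ?M) \<le> \<nu>"
      using degree_mult_le[of "[:b, c:]" ?M] degM \<nu> by (auto split: if_splits)
    moreover have "coeff ([:b, c:] * ?M) \<nu> = c * ?a" using M\<nu> Mm by (simp add: \<nu>)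
    ultimately show ?thesis using a0 by (subst unit_integral_GL_poly_mult) auto
  qed
  \<comment> \<open>The differential equation controls \<open>(q L')'\<close>, so \<open>M\<close>
    is written as a derivative: integration by parts then turns \<open>q L' M\<close> into a
    multiple of \<open>L G\<close>.\<close>
  obtain G where G: "pderiv G = ?M" using pderiv_eq_exists by blast
  have degG: "degree G \<le> \<nu>"
    using degree_pderiv[of G] degM \<nu> by (simp add: G)
  have "coeff G \<nu> = ?a / real \<nu>"
    using arg_cong[OF G, of "\<lambda>f. coeff f m"] Mm by (simp add: coeff_pderiv \<nu> field_simps)
  hence LG: "unit_integral (?L * G) = ?N / real \<nu>"
    using a0 by (subst unit_integral_GL_poly_mult[OF degG]) simp
  have "unit_integral (?q * pderiv ?L * ?M) = - unit_integral (pderiv (?q * pderiv ?L) * G)"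
    using unit_integral_by_parts[of "?q * pderiv ?L" G] by (simp add: G)
  also have "\<dots> = (real \<nu> * (real \<nu> + 1)) * unit_integral (?L * G)"
    unfolding GL_poly_ODE by (simp add: unit_integral_smult unit_integral_minus)
  also have "\<dots> = (real \<nu> + 1) * ?N" unfolding LG using \<nu> by simp
  finally have qLM: "unit_integral (?q * pderiv ?L * ?M) = (real \<nu> + 1) * ?N" .
  have dL: "pderiv ?L = ?M + [:-p, 1:] * pderiv ?M"
    by (subst L, subst pderiv_mult) (simp add: pderiv_pCons)
  have dq: "pderiv ?q = [:1, -2:]" by (simp add: pderiv_pCons)
  have "pderiv (?q * ?L * ?M) =
      ?L * ([:1, -2:] * ?M) + ?q * pderiv ?L * ?M + ?q * ?L * pderiv ?M"
    unfolding pderiv_mult dq by (simp only: algebra_simps)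
  also have "?q * ?L * pderiv ?M = ?q * ([:-p, 1:] * pderiv ?M) * ?M"
    by (subst L) (simp only: mult_ac)
  also have "?q * ([:-p, 1:] * pderiv ?M) * ?M = ?q * pderiv ?L * ?M - ?q * (?M * ?M)"
    unfolding dL by (simp only: algebra_simps)
  finally have "unit_integral (pderiv (?q * ?L * ?M)) =
      - 2 * ?N + 2 * ((real \<nu> + 1) * ?N) - unit_integral (?q * (?M * ?M))"
    by (simp only: unit_integral_add unit_integral_diff LM qLM)
  hence qM: "unit_integral (?q * (?M * ?M)) = 2 * real \<nu> * ?N"
    by (simp add: unit_integral_pderiv algebra_simps)
  have "?q = [:p * (1 - p):] + [:-p, 1:] * [:1 - p, -1:]" by (simp add: algebra_simps)
  hence "?q * (?M * ?M) = [:p * (1 - p):] * (?M * ?M) + ([:-p, 1:] * ?M) * ([:1 - p, -1:] * ?M)"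
    by (simp only: algebra_simps)
  hence "?q * (?M * ?M) = smult (p * (1 - p)) (?M * ?M) + ?L * ([:1 - p, -1:] * ?M)"
    unfolding L[symmetric] by simp
  from arg_cong[OF this, of unit_integral] qM show ?thesis
    by (simp only: unit_integral_add unit_integral_smult LM) (simp add: algebra_simps)
qed

text \<open>The numerator does not depend on \<open>p\<close>; up to this constant,
  \<open>GL_weight\<close> is therefore the quadrature weight divided by sqrt(p(1 - p)).\<close>

lemma quad_weight_closed_form:
  "quad_weight \<nu> p = (2 * real \<nu> + 1) * unit_integral (GL_poly \<nu> * GL_poly \<nu>) /
     (p * (1 - p) * (poly (pderiv (GL_poly \<nu>)) p)\<^sup>2)"
proof -
  have "0 < p" "p < 1" using GL_support_subset[of \<nu>] p by auto
  thus ?thesis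
    unfolding quad_weight_eq_square pderiv_GL_poly_root[OF p] unit_integral_cofactor_square[symmetric]
    by simp
qed

end

section \<open>The singular sum\<close>

definition inv_sqrt_coeff :: "nat \<Rightarrow> real" where
  "inv_sqrt_coeff k = pochhammer (1 / 2) k / fact k"

lemma inv_sqrt_coeff_nonneg: "inv_sqrt_coeff k \<ge> 0"
  unfolding inv_sqrt_coeff_def by (intro divide_nonneg_pos pochhammer_nonneg) auto

text \<open>The binomial series for exponent -1/2: the signs of the binomial coefficient and of
  \<open>(- x) ^ k\<close> cancel, which leaves nonnegative coefficients.\<close>

lemma inv_sqrt_series:
  assumes "\<bar>x\<bar> < 1"
  shows "(\<lambda>k. inv_sqrt_coeff k * x ^ k) sums (1 - x) powr (- 1 / 2)"
proof -
  have "((- 1 / 2) gchoose k) * (- x) ^ k = inv_sqrt_coeff k * x ^ k" for k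
    by (simp add: gbinomial_pochhammer inv_sqrt_coeff_def power_minus[of x] flip: power_add)
  with gen_binomial_real[of "- x" "- 1 / 2"] assms show ?thesis by simp
qed

lemma inv_sqrt_series':
  assumes "\<bar>x\<bar> < 1"
  shows "(\<lambda>k. inv_sqrt_coeff k * x ^ (2 * k)) sums inverse (sqrt (1 - x\<^sup>2))"
proof -
  have "x\<^sup>2 < 1" using assms by (simp add: abs_square_less_1)
  moreover from this have "(1 - x\<^sup>2) powr (- 1 / 2) = inverse (sqrt (1 - x\<^sup>2))"
    by (simp add: powr_minus powr_half_sqrt flip: minus_divide_left)
  ultimately show ?thesis using inv_sqrt_series[of "x\<^sup>2"] by (simp add: power_mult)
qed

lemma arcsin_partial_sum_deriv:
  "((\<lambda>x. \<Sum>k<n. inv_sqrt_coeff k * x ^ (2 * k + 1) / real (2 * k + 1)) has_real_derivative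
     (\<Sum>k<n. inv_sqrt_coeff k * x ^ (2 * k))) (at x)"
proof -
  have "((\<lambda>x. inv_sqrt_coeff k * x ^ (2 * k + 1) / real (2 * k + 1)) has_real_derivative
     inv_sqrt_coeff k * x ^ (2 * k)) (at x)" for k
    by (rule DERIV_cong[OF DERIV_cdivide[OF DERIV_cmult[OF DERIV_pow]]])
       (simp del: of_nat_Suc of_nat_add of_nat_mult)
  thus ?thesis by (intro DERIV_sum)
qed

text \<open>The derivative of \<open>arcsin - T n\<close> is the tail \<open>r\<close> of a series
  with nonnegative coefficients, hence nonnegative and at most \<open>r x\<close> on [0, x]. Thus
  \<open>arcsin - T n\<close> is nondecreasing and \<open>arcsin y - T n y - r x * y\<close> is
  nonincreasing in \<open>y\<close>.\<close>

lemma arcsin_bounds: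
  fixes x :: real
  assumes "0 \<le> x" "x < 1"
  defines "T \<equiv> \<lambda>n x. \<Sum>k<n. inv_sqrt_coeff k * x ^ (2 * k + 1) / real (2 * k + 1)"
  shows "T n x \<le> arcsin x"
    and "arcsin x \<le> T n x + (inverse (sqrt (1 - x\<^sup>2)) - (\<Sum>k<n. inv_sqrt_coeff k * x ^ (2 * k)))"
proof -
  define r where "r = (\<lambda>y. inverse (sqrt (1 - y\<^sup>2)) - (\<Sum>k<n. inv_sqrt_coeff k * y ^ (2 * k)))"
  have tail: "r y = (\<Sum>k. inv_sqrt_coeff (k + n) * y ^ (2 * (k + n)))"
    "summable (\<lambda>k. inv_sqrt_coeff (k + n) * y ^ (2 * (k + n)))" if "0 \<le> y" "y \<le> x" for y
  proof -
    from that assms have "\<bar>y\<bar> < 1" by simp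
    note s = inv_sqrt_series'[OF this]
    show "summable (\<lambda>k. inv_sqrt_coeff (k + n) * y ^ (2 * (k + n)))"
      using sums_summable[OF s] by (subst summable_iff_shift)
    show "r y = (\<Sum>k. inv_sqrt_coeff (k + n) * y ^ (2 * (k + n)))"
      using suminf_minus_initial_segment[OF sums_summable[OF s], of n] sums_unique[OF s]
      by (simp add: r_def)
  qed
  have r0: "0 \<le> r y" and rx: "r y \<le> r x" if "0 \<le> y" "y \<le> x" for y
  proof -
    show "0 \<le> r y" unfolding tail(1)[OF that]
      by (intro suminf_nonneg tail that mult_nonneg_nonneg inv_sqrt_coeff_nonneg zero_le_power)
    show "r y \<le> r x" unfolding tail(1)[OF that] tail(1)[OF assms(1) order.refl]
      by (intro suminf_le tail that mult_left_mono power_mono inv_sqrt_coeff_nonneg assms order.refl)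
  qed
  have der: "((\<lambda>y. arcsin y - T n y) has_real_derivative r y) (at y)" if "0 \<le> y" "y \<le> x" for y
    unfolding r_def T_def using that assms
    by (intro DERIV_diff arcsin_partial_sum_deriv DERIV_arcsin) auto
  have T0: "T n 0 = 0" by (simp add: T_def)
  have "arcsin 0 - T n 0 \<le> arcsin x - T n x"
    by (rule DERIV_nonneg_imp_nondecreasing[where f = "\<lambda>y. arcsin y - T n y"]) (use assms der r0 in auto)
  thus "T n x \<le> arcsin x" using T0 by simp
  have "arcsin 0 - T n 0 - r x * 0 \<ge> arcsin x - T n x - r x * x"
  proof (rule DERIV_nonpos_imp_nonincreasing[where f = "\<lambda>y. arcsin y - T n y - r x * y"])
    fix y assume "0 \<le> y" "y \<le> x"
    hence "((\<lambda>y. arcsin y - T n y - r x * y) has_real_derivative (r y - r x)) (at y)"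
      by (intro DERIV_diff der DERIV_cmult_Id)
    thus "\<exists>d. ((\<lambda>y. arcsin y - T n y - r x * y) has_real_derivative d) (at y) \<and> d \<le> 0"
      using rx[OF \<open>0 \<le> y\<close> \<open>y \<le> x\<close>] by force
  qed (use assms in auto)
  hence "arcsin x \<le> T n x + r x * x" using T0 by simp
  also have "r x * x \<le> r x"
    using r0[of x] assms mult_left_mono[of x 1 "r x"] by simp
  finally show "arcsin x \<le> T n x + (inverse (sqrt (1 - x\<^sup>2)) - (\<Sum>k<n. inv_sqrt_coeff k * x ^ (2 * k)))"
    by (simp add: r_def)
qed

text \<open>The arcsine series at the endpoint 1. Letting x tend to 1 from the left bounds the
  partial sums by pi / 2; conversely each \<theta> below pi / 2 is the arcsine of some x < 1, where
  the series is dominated by its value at 1.\<close>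

lemma inv_sqrt_coeff_integral_sums:
  "(\<lambda>k. inv_sqrt_coeff k / real (2 * k + 1)) sums (pi / 2)"
proof -
  define T where "T = (\<lambda>n x. \<Sum>k<n. inv_sqrt_coeff k * x ^ (2 * k + 1) / real (2 * k + 1))"
  define b where "b = (\<lambda>k. inv_sqrt_coeff k / real (2 * k + 1))"
  have b0: "b k \<ge> 0" for k unfolding b_def by (simp add: inv_sqrt_coeff_nonneg)
  have T1: "T n 1 = (\<Sum>k<n. b k)" for n by (simp add: T_def b_def)
  have le: "(\<Sum>k<n. b k) \<le> pi / 2" for n
  proof -
    have "isCont (T n) 1" unfolding T_def by (rule DERIV_isCont[OF arcsin_partial_sum_deriv])
    hence "(T n \<longlongrightarrow> T n 1) (at_left 1)"
      by (simp add: continuous_within filterlim_at_split isCont_def)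
    moreover have "eventually (\<lambda>x. T n x \<le> pi / 2) (at_left 1)"
      using eventually_at_left_real[of 0 "1 :: real", simplified]
    proof eventually_elim
      case (elim x)
      thus ?case using arcsin_bounds(1)[of x n] arcsin_ubound[of x] unfolding T_def by simp
    qed
    ultimately have "T n 1 \<le> pi / 2" by (rule tendsto_upperbound) simp
    thus ?thesis by (simp add: T1)
  qed
  have sm: "summable b"
    by (rule summableI_nonneg_bounded[OF b0 le])
  have "suminf b \<le> pi / 2" by (rule suminf_le_const[OF sm le])
  moreover have "pi / 2 \<le> suminf b"
  proof (rule dense_le_bounded[of 0])
    show "0 < pi / 2" by simp
    fix \<theta> :: real assume \<theta>: "0 < \<theta>" "\<theta> < pi / 2"
    define x where "x = sin \<theta>"
    have "sin \<theta> < sin (pi / 2)" using \<theta> by (intro sin_monotone_2pi) auto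
    moreover have "sin \<theta> > 0" using \<theta> by (intro sin_gt_zero) auto
    ultimately have x: "0 \<le> x" "x < 1" by (auto simp: x_def)
    \<comment> \<open>For fixed \<open>x < 1\<close> the remainder bound vanishes as
      \<open>n\<close> grows.\<close>
    have lim: "(\<lambda>n. suminf b + (inverse (sqrt (1 - x\<^sup>2)) - (\<Sum>k<n. inv_sqrt_coeff k * x ^ (2 * k))))
        \<longlonglongrightarrow> suminf b + (inverse (sqrt (1 - x\<^sup>2)) - inverse (sqrt (1 - x\<^sup>2)))"
      using inv_sqrt_series'[of x] x unfolding sums_def by (intro tendsto_intros) auto
    have "arcsin x \<le> suminf b + (inverse (sqrt (1 - x\<^sup>2)) - (\<Sum>k<n. inv_sqrt_coeff k * x ^ (2 * k)))" for n
    proof -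
      have "T n x \<le> T n 1"
        unfolding T_def using x
        by (intro sum_mono divide_right_mono mult_left_mono power_mono inv_sqrt_coeff_nonneg) auto
      also have "\<dots> \<le> suminf b" unfolding T1 by (rule sum_le_suminf[OF sm]) (auto simp: b0)
      finally show ?thesis using arcsin_bounds(2)[OF x, of n] unfolding T_def by linarith
    qed
    hence "arcsin x \<le> suminf b + (inverse (sqrt (1 - x\<^sup>2)) - inverse (sqrt (1 - x\<^sup>2)))"
      by (intro tendsto_lowerbound[OF lim] always_eventually) auto
    moreover have "arcsin x = \<theta>" unfolding x_def using \<theta> by (intro arcsin_sin) auto
    ultimately show "\<theta> \<le> suminf b" by simp
  qed
  ultimately have "suminf b = pi / 2" by simp
  hence "b sums (pi / 2)" using summable_sums[OF sm] by metis
  thus ?thesis by (simp only: b_def)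
qed

section \<open>Division with nonnegative coefficients and the even moments\<close>

lemma poly_nonneg_coeffs:
  fixes p :: "real poly"
  assumes "\<And>k. coeff p k \<ge> 0" "x \<ge> 0"
  shows "poly p x \<ge> 0"
  unfolding poly_altdef using assms by (intro sum_nonneg) auto

text \<open>Horner's scheme at a nonnegative point only adds and multiplies nonnegative
  numbers.\<close>

lemma synthetic_div_nonneg_coeffs:
  fixes p :: "real poly"
  assumes "\<And>k. coeff p k \<ge> 0" "c \<ge> 0"
  shows "coeff (synthetic_div p c) k \<ge> 0"
  using assms(1)
proof (induction p arbitrary: k)
  case (pCons a p)
  have "coeff p j \<ge> 0" for j using pCons.prems[of "Suc j"] by simp
  with pCons.IH assms(2) show ?case
    by (auto simp: coeff_pCons poly_nonneg_coeffs split: nat.splits)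
qed simp

text \<open>One linear factor is split off at a time, and each scalar remainder, times the product
  so far, goes into \<open>B\<close>. Indexing by \<open>i\<close> admits repeated values
  \<open>z i\<close>, as occur for the nodes p and 1 - p. The case \<open>B = 0\<close> covers the
  empty product.\<close>

lemma nonneg_coeffs_div_prod:
  fixes V :: "real poly" and z :: "'a \<Rightarrow> real"
  assumes "finite X" "\<And>i. i \<in> X \<Longrightarrow> z i \<ge> 0" "\<And>k. coeff V k \<ge> 0"
  shows "\<exists>A B. V = A * (\<Prod>i\<in>X. [:- z i, 1:]) + B \<and> (\<forall>k. coeff A k \<ge> 0) \<and>
               (B = 0 \<or> degree B < card X)"
  using assms(1,2)
proof (induction X rule: finite_induct)
  case empty
  show ?case by (rule exI[of _ V], rule exI[of _ 0]) (use assms(3) in simp)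
next
  case (insert x X)
  then obtain A B where AB: "V = A * (\<Prod>i\<in>X. [:- z i, 1:]) + B" "\<forall>k. coeff A k \<ge> 0"
    "B = 0 \<or> degree B < card X" by auto
  define D where "D = (\<Prod>i\<in>X. [:- z i, 1:])"
  define A' where "A' = synthetic_div A (z x)"
  define B' where "B' = smult (poly A (z x)) D + B"
  have A: "A = [:- z x, 1:] * A' + [:poly A (z x):]"
    unfolding A'_def by (rule synthetic_div_correct'[symmetric])
  have "V = A' * ([:- z x, 1:] * D) + B'"
    unfolding AB(1) B'_def D_def[symmetric] by (subst A) (simp add: algebra_simps)
  moreover have "\<forall>k. coeff A' k \<ge> 0"
    unfolding A'_def using AB(2) insert.prems by (auto intro!: synthetic_div_nonneg_coeffs)
  moreover have "degree D \<le> card X"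
    unfolding D_def using degree_prod_sum_le[OF insert.hyps(1), of "\<lambda>i. [:- z i, 1:]"] by simp
  hence "degree B' \<le> card X"
    unfolding B'_def using AB(3)
    by (intro degree_add_le order.trans[OF degree_smult_le]) auto
  ultimately show ?case using insert.hyps by (intro exI[of _ A'] exI[of _ B']) (auto simp: D_def)
qed

lemma GL_poly_factorization:
  "GL_poly \<nu> = smult (lead_coeff (GL_poly \<nu>)) (\<Prod>p\<in>GL_support \<nu>. [:-p, 1:])"
proof (rule poly_eqI_degree_lead_coeff[of "GL_poly \<nu>" \<nu> _ "GL_support \<nu>"])
  have deg: "degree (\<Prod>p\<in>GL_support \<nu>. [:-p, 1:]) = \<nu>"
    by (subst degree_prod_eq_sum_degree) (auto simp: GL_support_card)
  have "lead_coeff (\<Prod>p\<in>GL_support \<nu>. [:-p, 1:]) = 1"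
    by (simp add: lead_coeff_prod)
  with deg show "coeff (GL_poly \<nu>) \<nu> =
      coeff (smult (lead_coeff (GL_poly \<nu>)) (\<Prod>p\<in>GL_support \<nu>. [:-p, 1:])) \<nu>" by simp
  show "degree (smult (lead_coeff (GL_poly \<nu>)) (\<Prod>p\<in>GL_support \<nu>. [:-p, 1:])) \<le> \<nu>"
    using deg by (intro order.trans[OF degree_smult_le]) simp
next
  fix z assume "z \<in> GL_support \<nu>"
  thus "poly (GL_poly \<nu>) z = poly (smult (lead_coeff (GL_poly \<nu>)) (\<Prod>p\<in>GL_support \<nu>. [:-p, 1:])) z"
    by (auto simp: GL_support_def poly_prod prod_zero_iff[OF GL_support_finite[unfolded GL_support_def]])
qed (auto simp: GL_support_card)

text \<open>Each factor is (2t - 1)^2 - (2p - 1)^2 = 4(t - p)(t - (1 - p)), and p \<mapsto> 1 - p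
  permutes the nodes, so every linear factor appears twice.\<close>

lemma GL_poly_square:
  "(\<Prod>p\<in>GL_support \<nu>. [:- ((2 * p - 1)\<^sup>2), 1:]) \<circ>\<^sub>p ([:-1, 2:]\<^sup>2) =
     smult (4 ^ \<nu> / (lead_coeff (GL_poly \<nu>))\<^sup>2) (GL_poly \<nu> * GL_poly \<nu>)"
proof -
  let ?X = "GL_support \<nu>" and ?a = "lead_coeff (GL_poly \<nu>)"
  let ?P = "\<Prod>p\<in>?X. [:-p, 1:]"
  have "bij_betw (\<lambda>p. 1 - p) ?X ?X"
    by (rule bij_betwI[of _ _ _ "\<lambda>p. 1 - p"]) (use GL_support_reflect[of _ \<nu>] in auto)
  hence P': "(\<Prod>p\<in>?X. [:-(1 - p), 1:]) = ?P"
    by (rule prod.reindex_bij_betw)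
  have a0: "?a \<noteq> 0" by (simp only: leading_coeff_0_iff GL_poly_nonzero not_False_eq_True)
  have "(\<Prod>p\<in>?X. [:- ((2 * p - 1)\<^sup>2), 1:]) \<circ>\<^sub>p ([:-1, 2:]\<^sup>2) =
      (\<Prod>p\<in>?X. [:4:] * ([:-p, 1:] * [:-(1 - p), 1:]))"
    unfolding pcompose_prod
    by (intro prod.cong) (simp_all add: pcompose_pCons power2_eq_square algebra_simps)
  also have "\<dots> = smult (4 ^ \<nu>) (?P * ?P)"
    unfolding prod.distrib P' by (simp add: GL_support_card poly_const_pow)
  also have "?P * ?P = smult (1 / ?a\<^sup>2) (GL_poly \<nu> * GL_poly \<nu>)"
    by (subst (3 4) GL_poly_factorization) (use a0 in \<open>simp add: power2_eq_square\<close>)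
  finally show ?thesis by simp
qed

lemma unit_integral_even_power:
  "unit_integral ([:-1, 2:] ^ (2 * k)) = 1 / real (2 * k + 1)"
proof -
  have "pderiv ([:-1, 2:] ^ Suc (2 * k)) = smult (2 * real (2 * k + 1)) ([:-1, 2 :: real:] ^ (2 * k))"
    unfolding pderiv_power_Suc by (simp add: pderiv_pCons)
  from arg_cong[OF this, of unit_integral] show ?thesis
    unfolding unit_integral_pderiv unit_integral_smult
    by (simp add: poly_power field_simps)
qed

definition even_moment :: "nat \<Rightarrow> nat \<Rightarrow> real" where
  "even_moment \<nu> k = (\<Sum>p\<in>GL_support \<nu>. quad_weight \<nu> p * (2 * p - 1) ^ (2 * k))"

lemma even_moment_eq: "k < \<nu> \<Longrightarrow> even_moment \<nu> k = 1 / real (2 * k + 1)"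
  using Gauss_quadrature[of "[:-1, 2:] ^ (2 * k)" \<nu>]
  by (simp add: unit_integral_even_power degree_power_eq even_moment_def poly_power mult.commute[of _ 2])

lemma even_moment_nonneg: "even_moment \<nu> k \<ge> 0"
  unfolding even_moment_def using quad_weight_pos
  by (intro sum_nonneg mult_nonneg_nonneg) (auto intro: less_imp_le simp: power_mult)

text \<open>Dividing \<open>v ^ k\<close> by \<open>\<Prod>\<^sub>p (v - (2 p - 1)\<^sup>2)\<close> leaves a quotient with nonnegative coefficients.
  Under \<open>v = (2 t - 1)\<^sup>2\<close> the divisor becomes a positive multiple of \<open>L\<^sup>2\<close>, so the quadrature
  formula underestimates the integral.\<close>
lemma even_moment_le:
  assumes "\<nu> > 0"
  shows "even_moment \<nu> k \<le> 1 / real (2 * k + 1)"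
proof -
  let ?L = "GL_poly \<nu>" and ?u = "[:-1, 2 :: real:]\<^sup>2"
  obtain A B where AB: "monom 1 k = A * (\<Prod>p\<in>GL_support \<nu>. [:- ((2 * p - 1)\<^sup>2), 1:]) + B"
    "\<forall>k. coeff A k \<ge> 0" "B = 0 \<or> degree B < card (GL_support \<nu>)"
    using nonneg_coeffs_div_prod[of "GL_support \<nu>" "\<lambda>p. (2 * p - 1)\<^sup>2" "monom 1 k"]
    by (fastforce split: if_splits)
  define C where "C = smult (4 ^ \<nu> / (lead_coeff ?L)\<^sup>2) (?L * ?L)"
  have "[:-1, 2:] ^ (2 * k) = monom 1 k \<circ>\<^sub>p ?u"
    by (simp add: monom_altdef pcompose_power pcompose_mult pcompose_pCons power_mult)
  also have "\<dots> = (A \<circ>\<^sub>p ?u) * C + B \<circ>\<^sub>p ?u"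
    unfolding AB(1) pcompose_add pcompose_mult GL_poly_square C_def ..
  finally have eq: "[:-1, 2:] ^ (2 * k) = (A \<circ>\<^sub>p ?u) * C + B \<circ>\<^sub>p ?u" .
  have "degree (B \<circ>\<^sub>p ?u) < 2 * \<nu>"
    using AB(3) assms by (auto simp: degree_pcompose degree_power_eq GL_support_card)
  hence "unit_integral (B \<circ>\<^sub>p ?u) = (\<Sum>p\<in>GL_support \<nu>. quad_weight \<nu> p * poly (B \<circ>\<^sub>p ?u) p)"
    by (rule Gauss_quadrature)
  also have "\<dots> = even_moment \<nu> k"
    unfolding even_moment_def
  proof (intro sum.cong refl arg_cong2[where f = "(*)"])
    fix p assume "p \<in> GL_support \<nu>"
    hence "poly C p = 0" by (simp add: C_def GL_support_def)
    with arg_cong[OF eq, of "\<lambda>f. poly f p"] show "poly (B \<circ>\<^sub>p ?u) p = (2 * p - 1) ^ (2 * k)"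
      by (simp add: poly_power algebra_simps)
  qed
  finally have B: "unit_integral (B \<circ>\<^sub>p ?u) = even_moment \<nu> k" .
  have "unit_integral ((A \<circ>\<^sub>p ?u) * C) \<ge> 0"
  proof (rule unit_integral_nonneg)
    fix x :: real
    have "poly (A \<circ>\<^sub>p ?u) x \<ge> 0"
      unfolding poly_pcompose using AB(2) by (intro poly_nonneg_coeffs[of A]) (auto simp: poly_power)
    thus "poly ((A \<circ>\<^sub>p ?u) * C) x \<ge> 0" by (simp add: C_def)
  qed
  with arg_cong[OF eq, of unit_integral] B show ?thesis
    by (simp add: unit_integral_even_power unit_integral_add)
qed

text \<open>The quadrature value for the integral of (t(1 - t))^(-1/2) over [0, 1]. It is also the
  normalising constant of the distribution relative to the quadrature weights.\<close>

definition GL_singular_sum :: "nat \<Rightarrow> real" where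
  "GL_singular_sum \<nu> = (\<Sum>p\<in>GL_support \<nu>. quad_weight \<nu> p * inverse (sqrt (p * (1 - p))))"

lemma GL_singular_sum_sums:
  "(\<lambda>k. 2 * (inv_sqrt_coeff k * even_moment \<nu> k)) sums GL_singular_sum \<nu>"
proof -
  have eq: "2 * inverse (sqrt (1 - (2 * p - 1)\<^sup>2)) = inverse (sqrt (p * (1 - p)))" for p :: real
  proof -
    have "1 - (2 * p - 1)\<^sup>2 = 2\<^sup>2 * (p * (1 - p))" by (simp add: power2_eq_square algebra_simps)
    thus ?thesis by (simp only: real_sqrt_mult real_sqrt_abs) simp
  qed
  have "(\<lambda>k. \<Sum>p\<in>GL_support \<nu>. quad_weight \<nu> p * (2 * (inv_sqrt_coeff k * (2 * p - 1) ^ (2 * k)))) sums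
        (\<Sum>p\<in>GL_support \<nu>. quad_weight \<nu> p * (2 * inverse (sqrt (1 - (2 * p - 1)\<^sup>2))))"
    using GL_support_subset[of \<nu>]
    by (intro sums_sum sums_mult inv_sqrt_series') (auto simp: abs_less_iff subset_iff)
  moreover have "(\<Sum>p\<in>GL_support \<nu>. quad_weight \<nu> p * (2 * (inv_sqrt_coeff k * (2 * p - 1) ^ (2 * k)))) =
      2 * (inv_sqrt_coeff k * even_moment \<nu> k)" for k
    unfolding even_moment_def sum_distrib_left by (intro sum.cong refl) (simp only: mult_ac)
  ultimately show ?thesis by (simp only: eq GL_singular_sum_def)
qed

text \<open>From below the series is cut after \<nu> terms, on which the moments are exact; from
  above the moments are compared term by term.\<close>

lemma GL_singular_sum_tendsto: "GL_singular_sum \<longlonglongrightarrow> pi"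
proof (rule tendsto_sandwich)
  let ?b = "\<lambda>k. 2 * (inv_sqrt_coeff k / real (2 * k + 1))"
  have b: "?b sums pi" using sums_mult[OF inv_sqrt_coeff_integral_sums, of 2] by simp
  thus "(\<lambda>n. \<Sum>k<n. ?b k) \<longlonglongrightarrow> pi" unfolding sums_def .
  show "eventually (\<lambda>\<nu>. (\<Sum>k<\<nu>. ?b k) \<le> GL_singular_sum \<nu>) sequentially"
  proof (rule always_eventually, rule allI)
    fix \<nu>
    have "(\<Sum>k<\<nu>. ?b k) = (\<Sum>k<\<nu>. 2 * (inv_sqrt_coeff k * even_moment \<nu> k))"
      by (intro sum.cong) (auto simp: even_moment_eq)
    also have "\<dots> \<le> (\<Sum>k. 2 * (inv_sqrt_coeff k * even_moment \<nu> k))"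
      using inv_sqrt_coeff_nonneg even_moment_nonneg GL_singular_sum_sums
      by (intro sum_le_suminf) (auto simp: sums_iff)
    finally show "(\<Sum>k<\<nu>. ?b k) \<le> GL_singular_sum \<nu>"
      using GL_singular_sum_sums[of \<nu>] by (simp add: sums_iff)
  qed
  show "eventually (\<lambda>\<nu>. GL_singular_sum \<nu> \<le> pi) sequentially"
    using eventually_gt_at_top[of 0]
  proof eventually_elim
    case (elim \<nu>)
    show ?case
    proof (rule sums_le[OF _ GL_singular_sum_sums b])
      fix k show "2 * (inv_sqrt_coeff k * even_moment \<nu> k) \<le> ?b k"
        using mult_left_mono[OF even_moment_le[OF elim, of k] inv_sqrt_coeff_nonneg[of k]] by simp
    qed
  qed
qed simp

section \<open>The smallest node\<close>

definition bessel_coeff :: "nat \<Rightarrow> real" where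
  "bessel_coeff k = (-1) ^ k / (fact k)\<^sup>2"

text \<open>For y \<ge> 0 this is J0(2 sqrt y). As a power series in y it can be compared with
  polynomials coefficient by coefficient.\<close>

definition bessel_fun :: "real \<Rightarrow> real" where
  "bessel_fun y = (\<Sum>k. bessel_coeff k * y ^ k)"

lemma J0_eq_bessel_fun: "J0 t = bessel_fun ((t / 2)\<^sup>2)"
  unfolding J0_def bessel_fun_def bessel_coeff_def by (simp add: power_mult)

lemma abs_bessel_coeff_le: "\<bar>bessel_coeff k\<bar> \<le> 1 / fact k"
proof -
  have "\<bar>bessel_coeff k\<bar> = 1 / fact k * (1 / fact k)"
    by (simp add: bessel_coeff_def power2_eq_square)
  also have "\<dots> \<le> 1 / fact k * 1" by (intro mult_left_mono) (auto simp: fact_ge_1)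
  finally show ?thesis by simp
qed

lemma abs_bessel_term_le: "\<bar>bessel_coeff k * y ^ k\<bar> \<le> \<bar>y\<bar> ^ k / fact k"
  using mult_right_mono[OF abs_bessel_coeff_le, of "\<bar>y\<bar> ^ k" k] by (simp add: abs_mult power_abs)

lemma summable_abs_power_fact: "summable (\<lambda>k. \<bar>y\<bar> ^ k / fact k :: real)"
  using summable_exp[of "\<bar>y\<bar>"] by (simp add: field_simps)

lemma bessel_summable: "summable (\<lambda>k. bessel_coeff k * y ^ k)"
  by (rule summable_comparison_test'[OF summable_abs_power_fact[of y]]) (simp add: abs_bessel_term_le)

lemma bessel_coeff_Suc: "bessel_coeff k = - (real (Suc k))\<^sup>2 * bessel_coeff (Suc k)"
  unfolding bessel_coeff_def by (simp add: power_mult_distrib del: of_nat_Suc)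

text \<open>\<open>H = - y F'\<close> satisfies \<open>H' = F\<close>: this is Bessel's equation for \<open>F\<close>.\<close>
lemma bessel_fun_ODE:
  obtains F' H where
    "\<And>y. (bessel_fun has_real_derivative F' y) (at y)"
    "\<And>y. (H has_real_derivative bessel_fun y) (at y)"
    "\<And>y. H y = - y * F' y"
proof
  define F' where "F' = (\<lambda>y. \<Sum>k. diffs bessel_coeff k * y ^ k)"
  define e where "e = (\<lambda>k. - real k * bessel_coeff k)"
  define H where "H = (\<lambda>y. \<Sum>k. e k * y ^ k)"
  show F': "(bessel_fun has_real_derivative F' y) (at y)" for y
    unfolding bessel_fun_def F'_def
    by (rule termdiffs_strong_converges_everywhere[OF bessel_summable])
  have sF': "summable (\<lambda>k. diffs bessel_coeff k * y ^ k)" for y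
    by (rule termdiff_converges_all[OF bessel_summable])
  have e: "e (Suc k) * y ^ Suc k = - y * (diffs bessel_coeff k * y ^ k)" for k y
    by (simp add: e_def diffs_def)
  have sH': "summable (\<lambda>k. e (Suc k) * y ^ Suc k)" for y
    unfolding e by (intro summable_mult sF')
  have sH: "summable (\<lambda>k. e k * y ^ k)" for y
    using sH' by (subst (asm) summable_Suc_iff)
  have "diffs e = bessel_coeff"
    by (rule ext, subst bessel_coeff_Suc) (simp add: diffs_def e_def power2_eq_square algebra_simps)
  thus "(H has_real_derivative bessel_fun y) (at y)" for y
    using termdiffs_strong_converges_everywhere[OF sH, of y] by (simp add: H_def bessel_fun_def)
  show "H y = - y * F' y" for y
  proof -
    have "H y = (\<Sum>k. e (Suc k) * y ^ Suc k)"
      unfolding H_def using suminf_split_head[OF sH, of y] by (simp add: e_def)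
    also have "\<dots> = - y * F' y" unfolding e F'_def by (rule suminf_mult[OF sF'])
    finally show ?thesis .
  qed
qed

lemma continuous_on_bessel_fun: "continuous_on A bessel_fun"
  using bessel_fun_ODE by (metis DERIV_isCont continuous_at_imp_continuous_on)

lemma bessel_fun_0: "bessel_fun 0 = 1"
  using suminf_finite[of "{0}" "\<lambda>k. bessel_coeff k * 0 ^ k"]
  by (simp add: bessel_fun_def bessel_coeff_def power_0_left)

text \<open>The first five terms sum to -7/36, and the rest is bounded by a geometric series. With
  the value 1 at 0 this forces a zero in [0, 2].\<close>

lemma bessel_fun_2_neg: "bessel_fun 2 < 0"
proof -
  let ?f = "\<lambda>k. bessel_coeff k * 2 ^ k"
  have step: "\<bar>?f n\<bar> = (real (Suc n))\<^sup>2 * \<bar>?f (Suc n)\<bar> / 2" for n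
    by (subst bessel_coeff_Suc) (simp add: abs_mult del: of_nat_Suc)
  \<comment> \<open>The start 32 / 14400 is 2^5 / (5!)^2; from index 5 on, consecutive terms shrink
    by far more than a half.\<close>
  have tail: "\<bar>?f (k + 5)\<bar> \<le> 32 / 14400 * (1 / 2) ^ k" for k
  proof (induction k)
    case 0
    show ?case by (simp add: bessel_coeff_def fact_numeral)
  next
    case (Suc k)
    have "(real (Suc (k + 5)))\<^sup>2 \<ge> 6\<^sup>2" by (intro power_mono) auto
    hence "(real (Suc (k + 5)))\<^sup>2 * \<bar>?f (Suc k + 5)\<bar> \<ge> 4 * \<bar>?f (Suc k + 5)\<bar>"
      by (intro mult_right_mono) auto
    moreover have "\<bar>?f (k + 5)\<bar> = (real (Suc (k + 5)))\<^sup>2 * \<bar>?f (Suc k + 5)\<bar> / 2"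
      unfolding add_Suc by (rule step)
    ultimately show ?case using Suc.IH by simp
  qed
  have geo: "summable (\<lambda>k. 32 / 14400 * (1 / 2 :: real) ^ k)"
    by (intro summable_mult summable_geometric) simp
  have "(\<Sum>k. ?f (k + 5)) \<le> (\<Sum>k. 32 / 14400 * (1 / 2) ^ k)"
    by (intro suminf_le geo abs_le_D1[OF tail] summable_ignore_initial_segment bessel_summable)
  also have "\<dots> = 64 / 14400"
    by (subst suminf_mult) (auto simp: suminf_geometric)
  finally have "(\<Sum>k. ?f (k + 5)) \<le> 64 / 14400" .
  moreover have "(\<Sum>k<5. ?f k) = - 7 / 36"
    by (simp add: bessel_coeff_def numeral_eq_Suc fact_numeral field_simps)
  moreover have "bessel_fun 2 = (\<Sum>k. ?f (k + 5)) + (\<Sum>k<5. ?f k)"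
    unfolding bessel_fun_def by (rule suminf_split_initial_segment[OF bessel_summable])
  ultimately show ?thesis by simp
qed

lemma bessel_fun_first_root:
  obtains y where "y > 0" "bessel_fun y = 0" "\<And>z. 0 \<le> z \<Longrightarrow> z < y \<Longrightarrow> bessel_fun z \<noteq> 0"
proof -
  define Z where "Z = {y \<in> {0..2}. bessel_fun y = 0}"
  have "closed Z"
    unfolding Z_def by (intro continuous_closed_preimage_constant continuous_on_bessel_fun) auto
  moreover have "\<exists>y\<ge>0. y \<le> 2 \<and> bessel_fun y = 0"
    using bessel_fun_0 bessel_fun_2_neg by (intro IVT2' continuous_on_bessel_fun) auto
  hence "Z \<noteq> {}" unfolding Z_def by auto
  moreover have bdd: "bdd_below Z" unfolding Z_def by (rule bdd_belowI[of _ 0]) auto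
  ultimately have Inf: "Inf Z \<in> Z" by (intro closed_contains_Inf)
  show ?thesis
  proof (rule that[of "Inf Z"])
    show "bessel_fun (Inf Z) = 0" using Inf by (simp add: Z_def)
    show "Inf Z > 0"
      using Inf bessel_fun_0 by (cases "Inf Z = 0") (auto simp: Z_def)
    fix z assume "0 \<le> z" "z < Inf Z"
    thus "bessel_fun z \<noteq> 0"
      using cInf_lower[OF _ bdd, of z] Inf by (auto simp: Z_def)
  qed
qed

text \<open>Justifies the definite description: t = 2 sqrt y carries over the first zero of
  \<open>bessel_fun\<close>, and of two distinct first zeros the smaller would contradict the
  larger.\<close>

lemma j1_properties:
  "j1 > 0 \<and> J0 j1 = 0 \<and> (\<forall>s. 0 < s \<and> s < j1 \<longrightarrow> J0 s \<noteq> 0)"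
  unfolding j1_def
proof (rule theI')
  obtain y where y: "y > 0" "bessel_fun y = 0" "\<And>z. 0 \<le> z \<Longrightarrow> z < y \<Longrightarrow> bessel_fun z \<noteq> 0"
    using bessel_fun_first_root by blast
  let ?P = "\<lambda>t. t > 0 \<and> J0 t = 0 \<and> (\<forall>s. 0 < s \<and> s < t \<longrightarrow> J0 s \<noteq> 0)"
  have "?P (2 * sqrt y)"
  proof (intro conjI allI impI)
    fix s assume s: "0 < s \<and> s < 2 * sqrt y"
    hence "(s / 2)\<^sup>2 < (sqrt y)\<^sup>2" by (intro power_strict_mono) auto
    thus "J0 s \<noteq> 0" using y by (auto simp: J0_eq_bessel_fun)
  qed (use y in \<open>auto simp: J0_eq_bessel_fun\<close>)
  moreover have "t = t'" if "?P t" "?P t'" for t t'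
    using that by (metis linorder_neqE_linordered_idom)
  ultimately show "\<exists>!t. ?P t" by blast
qed

lemma j1_pos: "j1 > 0"
  and J0_j1: "J0 j1 = 0"
  and J0_nonzero_below_j1: "0 < s \<Longrightarrow> s < j1 \<Longrightarrow> J0 s \<noteq> 0"
  using j1_properties by blast+

lemma bessel_fun_j1: "bessel_fun ((j1 / 2)\<^sup>2) = 0"
  using J0_j1 by (simp only: J0_eq_bessel_fun)

lemma bessel_fun_pos:
  assumes "0 \<le> y" "y < (j1 / 2)\<^sup>2"
  shows "bessel_fun y > 0"
proof (rule ccontr)
  assume "\<not> ?thesis"
  hence "\<exists>z\<ge>0. z \<le> y \<and> bessel_fun z = 0"
    using assms bessel_fun_0 by (intro IVT2' continuous_on_bessel_fun) auto
  then obtain z where z: "0 \<le> z" "z \<le> y" "bessel_fun z = 0" by auto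
  hence z0: "z > 0" using bessel_fun_0 by (cases "z = 0") auto
  have "(sqrt z)\<^sup>2 < (j1 / 2)\<^sup>2" using z assms by simp
  hence "sqrt z < j1 / 2" by (rule power2_less_imp_less) (use j1_pos in simp)
  hence "J0 (2 * sqrt z) \<noteq> 0" using z0 by (intro J0_nonzero_below_j1) auto
  thus False using z by (simp add: J0_eq_bessel_fun)
qed

text \<open>The first zero is a sign change: \<open>H\<close> starts at 0 and increases while
  \<open>bessel_fun\<close> is positive, so \<open>H = - y F'\<close> makes \<open>F'\<close>
  negative at the zero.\<close>

lemma bessel_fun_neg_right:
  assumes "b > (j1 / 2)\<^sup>2"
  shows "\<exists>y. (j1 / 2)\<^sup>2 < y \<and> y < b \<and> bessel_fun y < 0"
proof -
  let ?y = "(j1 / 2)\<^sup>2"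
  obtain F' H where FH: "\<And>y. (bessel_fun has_real_derivative F' y) (at y)"
    "\<And>y. (H has_real_derivative bessel_fun y) (at y)" "\<And>y. H y = - y * F' y"
    using bessel_fun_ODE by blast
  have y0: "?y > 0" using j1_pos by simp
  have "H 0 < H ?y"
  proof (rule DERIV_pos_imp_increasing_open[OF y0])
    show "continuous_on {0..?y} H"
      using FH(2) DERIV_isCont by (blast intro: continuous_at_imp_continuous_on)
    fix y assume "0 < y" "y < ?y"
    hence "bessel_fun y > 0" by (intro bessel_fun_pos) auto
    with FH(2) show "\<exists>d. (H has_real_derivative d) (at y) \<and> d > 0" by blast
  qed
  hence "F' ?y < 0" using FH(3)[of 0] FH(3)[of ?y] y0 by (simp add: mult_less_0_iff)
  from DERIV_neg_dec_right[OF FH(1) this] obtain d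
    where d: "d > 0" "\<And>h. h > 0 \<Longrightarrow> h < d \<Longrightarrow> bessel_fun (?y + h) < 0"
    using bessel_fun_j1 by auto
  define h where "h = min (d / 2) ((b - ?y) / 2)"
  have "h > 0" "h < d" "?y + h < b" using d assms by (auto simp: h_def min_def field_simps)
  thus ?thesis using d(2)[of h] by (intro exI[of _ "?y + h"]) auto
qed

section \<open>Mehler's limit of the rescaled Legendre polynomials\<close>

definition mehler_factor :: "nat \<Rightarrow> nat \<Rightarrow> real" where
  "mehler_factor \<nu> k = (\<Prod>j<k. 1 - real (j * (j + 1)) / real (\<nu> * (\<nu> + 1)))"

text \<open>While k \<le> \<nu> all factors lie in [0, 1], and the defect from 1 is at most the sum
  of the j(j + 1) over \<nu>(\<nu> + 1). Once k exceeds \<nu>, the factor with j = \<nu> makes the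
  product zero and the cubic bound is at least 1.\<close>

lemma mehler_factor_bounds:
  assumes "\<nu> > 0"
  shows "0 \<le> mehler_factor \<nu> k" "mehler_factor \<nu> k \<le> 1"
    and "1 - mehler_factor \<nu> k \<le> real k ^ 3 / real (\<nu> * (\<nu> + 1))"
    and "k > \<nu> \<Longrightarrow> mehler_factor \<nu> k = 0"
proof -
  let ?s = "real (\<nu> * (\<nu> + 1))"
  have s: "?s > 0" using assms by (subst of_nat_0_less_iff) simp
  show zero: "mehler_factor \<nu> k = 0" if "k > \<nu>" for k
    unfolding mehler_factor_def using that s by (intro prod_zero) auto
  have "0 \<le> mehler_factor \<nu> k \<and> mehler_factor \<nu> k \<le> 1 \<and> 1 - mehler_factor \<nu> k \<le> real k ^ 3 / ?s"
  proof (induction k)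
    case 0
    thus ?case by (simp add: mehler_factor_def)
  next
    case (Suc k)
    show ?case
    proof (cases "k \<le> \<nu>")
      case True
      define f where "f = real (k * (k + 1)) / ?s"
      have "real (k * (k + 1)) \<le> ?s" using True by (intro of_nat_mono mult_mono) auto
      hence f: "0 \<le> f" "f \<le> 1" using s by (auto simp: f_def)
      have step: "mehler_factor \<nu> (Suc k) = mehler_factor \<nu> k * (1 - f)"
        by (simp add: mehler_factor_def f_def)
      have "mehler_factor \<nu> k * f \<le> 1 * f" using Suc f by (intro mult_right_mono) auto
      hence "1 - mehler_factor \<nu> (Suc k) \<le> real k ^ 3 / ?s + f"
        using Suc by (simp add: step algebra_simps)
      also have "\<dots> = (real k ^ 3 + real (k * (k + 1))) / ?s"
        unfolding f_def by (simp only: add_divide_distrib)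
      also have "\<dots> \<le> real (Suc k) ^ 3 / ?s"
        using s by (intro divide_right_mono) (auto simp: power3_eq_cube algebra_simps)
      finally show ?thesis
        using Suc f by (auto simp: step intro!: mult_le_one)
    next
      case False
      hence "?s \<le> real (Suc k ^ 3)"
        unfolding power3_eq_cube
        by (intro of_nat_mono order.trans[OF mult_mono[of \<nu> "Suc k" "\<nu> + 1" "Suc k"]]) auto
      hence "1 \<le> real (Suc k) ^ 3 / ?s" using s by (simp add: le_divide_eq)
      moreover have "mehler_factor \<nu> (Suc k) = 0" using False by (intro zero) auto
      ultimately show ?thesis by simp
    qed
  qed
  thus "0 \<le> mehler_factor \<nu> k" "mehler_factor \<nu> k \<le> 1"
    "1 - mehler_factor \<nu> k \<le> real k ^ 3 / ?s" by auto
qed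

text \<open>Since (\<nu> - k)(\<nu> + k + 1) = \<nu>(\<nu> + 1) - k(k + 1), the Legendre recurrence
  is the Bessel recurrence times \<nu>(\<nu> + 1) and one more Mehler factor.\<close>

lemma coeff_GL_poly_mehler:
  assumes "\<nu> > 0"
  shows "coeff (GL_poly \<nu>) k =
    coeff (GL_poly \<nu>) 0 * (bessel_coeff k * mehler_factor \<nu> k * real (\<nu> * (\<nu> + 1)) ^ k)"
proof (induction k)
  case 0
  thus ?case by (simp add: bessel_coeff_def mehler_factor_def)
next
  case (Suc k)
  let ?s = "real (\<nu> * (\<nu> + 1))" and ?K = "(real (Suc k))\<^sup>2"
  have s: "?s \<noteq> 0" using assms by (subst of_nat_eq_0_iff) simp
  have "?K * coeff (GL_poly \<nu>) (Suc k) = - (?s * (1 - real (k * (k + 1)) / ?s)) * coeff (GL_poly \<nu>) k"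
    unfolding coeff_GL_poly_Suc using s by (simp add: right_diff_distrib) (simp add: algebra_simps)
  also have "\<dots> = ?K * (coeff (GL_poly \<nu>) 0 * (bessel_coeff (Suc k) * mehler_factor \<nu> (Suc k) * ?s ^ Suc k))"
    unfolding Suc.IH by (subst bessel_coeff_Suc) (simp add: mehler_factor_def mult_ac del: of_nat_Suc of_nat_mult)
  finally show ?case by (simp only: mult_cancel_left) simp
qed

lemma poly_GL_poly_scaled:
  assumes "\<nu> > 0"
  shows "(\<lambda>k. bessel_coeff k * mehler_factor \<nu> k * y ^ k) sums
           (poly (GL_poly \<nu>) (y / real (\<nu> * (\<nu> + 1))) / coeff (GL_poly \<nu>) 0)"
proof -
  let ?s = "real (\<nu> * (\<nu> + 1))"
  have s: "?s \<noteq> 0" using assms by (subst of_nat_eq_0_iff) simp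
  have c0: "coeff (GL_poly \<nu>) 0 \<noteq> 0" by (simp add: coeff_GL_poly)
  have "coeff (GL_poly \<nu>) k * (y / ?s) ^ k =
      coeff (GL_poly \<nu>) 0 * (bessel_coeff k * mehler_factor \<nu> k * y ^ k)" for k
    using s by (subst coeff_GL_poly_mehler[OF assms]) (simp add: power_divide del: of_nat_mult)
  hence "poly (GL_poly \<nu>) (y / ?s) / coeff (GL_poly \<nu>) 0 =
      (\<Sum>k\<le>\<nu>. bessel_coeff k * mehler_factor \<nu> k * y ^ k)"
    unfolding poly_altdef using c0 by (simp add: sum_distrib_left[symmetric] del: of_nat_mult)
  moreover have "(\<lambda>k. bessel_coeff k * mehler_factor \<nu> k * y ^ k) sums
      (\<Sum>k\<le>\<nu>. bessel_coeff k * mehler_factor \<nu> k * y ^ k)"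
    by (intro sums_finite) (auto simp: mehler_factor_bounds(4)[OF assms])
  ultimately show ?thesis by simp
qed

text \<open>The k-th terms differ by at most Y^k / k! times k^3 / (\<nu>(\<nu> + 1)), and k^3 \<le>
  8^k turns the sum into an exponential series.\<close>

lemma GL_poly_scaled_approx:
  assumes "\<nu> > 0" "\<bar>y\<bar> \<le> Y"
  shows "\<bar>poly (GL_poly \<nu>) (y / real (\<nu> * (\<nu> + 1))) / coeff (GL_poly \<nu>) 0 - bessel_fun y\<bar>
           \<le> exp (8 * Y) / real (\<nu> * (\<nu> + 1))"
proof -
  let ?s = "real (\<nu> * (\<nu> + 1))"
  let ?d = "\<lambda>k. bessel_coeff k * mehler_factor \<nu> k * y ^ k - bessel_coeff k * y ^ k"
  have s: "?s > 0" using assms by (subst of_nat_0_less_iff) simp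
  have d: "?d sums (poly (GL_poly \<nu>) (y / ?s) / coeff (GL_poly \<nu>) 0 - bessel_fun y)"
    unfolding bessel_fun_def
    by (intro sums_diff poly_GL_poly_scaled assms summable_sums bessel_summable)
  have bound: "\<bar>?d k\<bar> \<le> (8 * Y) ^ k /\<^sub>R fact k / ?s" for k
  proof -
    have "real k \<le> 2 ^ k" using of_nat_less_two_power[of k, where 'a = real] by simp
    hence "real k ^ 3 \<le> (2 ^ k) ^ 3" by (rule power_mono) simp
    also have "\<dots> = (2 ^ 3) ^ k" by (simp only: mult.commute flip: power_mult)
    also have "\<dots> = 8 ^ k" by simp
    finally have "1 - mehler_factor \<nu> k \<le> 8 ^ k / ?s"
      using mehler_factor_bounds(3)[OF assms(1), of k] s
      by (meson divide_right_mono less_imp_le order.trans)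
    moreover have "\<bar>bessel_coeff k * y ^ k\<bar> \<le> Y ^ k / fact k"
      using abs_bessel_term_le[of k y] power_mono[OF assms(2), of k]
      by (meson abs_ge_zero divide_right_mono fact_ge_zero order.trans)
    moreover have "\<bar>?d k\<bar> = \<bar>bessel_coeff k * y ^ k\<bar> * (1 - mehler_factor \<nu> k)"
    proof -
      have "?d k = - (bessel_coeff k * y ^ k * (1 - mehler_factor \<nu> k))" by (simp add: algebra_simps)
      thus ?thesis using mehler_factor_bounds(2)[OF assms(1), of k] by (simp add: abs_mult)
    qed
    ultimately have "\<bar>?d k\<bar> \<le> (Y ^ k / fact k) * (8 ^ k / ?s)"
      using mehler_factor_bounds(2)[OF assms(1), of k] assms(2)
      by (simp only:) (intro mult_mono, auto)
    thus ?thesis by (simp add: power_mult_distrib field_simps del: of_nat_mult)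
  qed
  have e: "(\<lambda>k. (8 * Y) ^ k /\<^sub>R fact k / ?s) sums (exp (8 * Y) / ?s)"
    by (intro sums_divide exp_converges)
  have "norm (suminf ?d) \<le> (\<Sum>k. (8 * Y) ^ k /\<^sub>R fact k / ?s)"
    using bound by (intro norm_suminf_le sums_summable[OF e]) auto
  thus ?thesis using sums_unique[OF d] sums_unique[OF e] by simp
qed

section \<open>Location of the smallest node\<close>

lemma GL_p0_in_support:
  assumes "\<nu> > 0"
  shows "GL_p0 \<nu> \<in> GL_support \<nu>"
proof -
  have "GL_support \<nu> \<noteq> {}" using GL_support_card[of \<nu>] assms by auto
  thus ?thesis unfolding GL_p0_def by (intro Min_in) auto
qed

text \<open>Left of the limit the Bessel function has a positive minimum, larger than the
  approximation error, so no node lies there. Just right of it there is a point with negative value,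
  which forces a sign change of the Legendre polynomial before that point.\<close>

lemma GL_p0_scaled_tendsto:
  "(\<lambda>\<nu>. real (\<nu> * (\<nu> + 1)) * GL_p0 \<nu>) \<longlonglongrightarrow> (j1 / 2)\<^sup>2"
proof -
  let ?s = "\<lambda>\<nu>. real (\<nu> * (\<nu> + 1))"
  have s_top: "filterlim ?s at_top sequentially"
  proof (rule filterlim_at_top_mono[OF filterlim_real_sequentially])
    show "eventually (\<lambda>\<nu>. real \<nu> \<le> ?s \<nu>) sequentially" by (intro always_eventually allI of_nat_mono) simp
  qed
  have small: "eventually (\<lambda>\<nu>. \<nu> > 0 \<and> C / ?s \<nu> < m) sequentially" if "m > 0" for C m :: real
  proof -
    have "(\<lambda>\<nu>. C / ?s \<nu>) \<longlonglongrightarrow> 0"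
      by (rule real_tendsto_divide_at_top[OF tendsto_const s_top])
    from order_tendstoD(2)[OF this that] show ?thesis
      using eventually_gt_at_top[of 0] by eventually_elim simp
  qed
  show ?thesis
  proof (rule order_tendstoI)
    fix a assume a: "a < (j1 / 2)\<^sup>2"
    \<comment> \<open>\<open>a\<close> may be negative; the maximum keeps \<open>{0..a'}\<close>
      nonempty, so that a minimum exists.\<close>
    define a' where "a' = max a 0"
    have a': "0 \<le> a'" "a' < (j1 / 2)\<^sup>2" using a j1_pos by (auto simp: a'_def)
    obtain x where x: "x \<in> {0..a'}" "\<And>y. y \<in> {0..a'} \<Longrightarrow> bessel_fun x \<le> bessel_fun y"
      using continuous_attains_inf[OF compact_Icc _ continuous_on_bessel_fun, of 0 a'] a' by auto
    have "bessel_fun x > 0" using x a' by (intro bessel_fun_pos) auto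
    from small[OF this, of "exp (8 * a')"]
    show "eventually (\<lambda>\<nu>. a < ?s \<nu> * GL_p0 \<nu>) sequentially"
    proof eventually_elim
      case (elim \<nu>)
      let ?y = "?s \<nu> * GL_p0 \<nu>"
      have p0: "GL_p0 \<nu> > 0" "poly (GL_poly \<nu>) (GL_p0 \<nu>) = 0"
        using GL_p0_in_support[of \<nu>] GL_support_subset[of \<nu>] elim by (auto simp: GL_support_def)
      have s: "?s \<nu> > 0" using elim by (subst of_nat_0_less_iff) simp
      show ?case
      proof (rule ccontr)
        assume "\<not> ?case"
        hence y: "?y \<in> {0..a'}" using p0 s by (auto simp: a'_def simp del: of_nat_mult)
        have "\<bar>0 - bessel_fun ?y\<bar> \<le> exp (8 * a') / ?s \<nu>"
          using GL_poly_scaled_approx[of \<nu> ?y a'] y elim p0 s by (simp del: of_nat_mult)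
        thus False using elim x(2)[OF y] by linarith
      qed
    qed
  next
    fix b assume "b > (j1 / 2)\<^sup>2"
    then obtain y where y: "(j1 / 2)\<^sup>2 < y" "y < b" "bessel_fun y < 0"
      using bessel_fun_neg_right by blast
    have y0: "y > 0" using y(1) by (rule le_less_trans[OF zero_le_power2])
    have "- bessel_fun y > 0" using y by simp
    from small[OF this, of "exp (8 * y)"]
    show "eventually (\<lambda>\<nu>. ?s \<nu> * GL_p0 \<nu> < b) sequentially"
    proof eventually_elim
      case (elim \<nu>)
      let ?L = "poly (GL_poly \<nu>)"
      have s: "?s \<nu> > 0" using elim by (subst of_nat_0_less_iff) simp
      have c0: "coeff (GL_poly \<nu>) 0 = ?L 0" by (simp add: poly_0_coeff_0)
      have "?L (y / ?s \<nu>) / ?L 0 < 0"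
        using GL_poly_scaled_approx[of \<nu> y y] y0 elim unfolding c0 by linarith
      hence "?L 0 * ?L (y / ?s \<nu>) < 0" by (auto simp: divide_less_0_iff mult_less_0_iff simp del: of_nat_mult)
      then obtain z where z: "0 < z" "z < y / ?s \<nu>" "?L z = 0"
        using poly_IVT[of 0 "y / ?s \<nu>" "GL_poly \<nu>"] y0 s by auto
      have "GL_p0 \<nu> \<le> z" unfolding GL_p0_def using z by (intro Min_le GL_support_finite) (auto simp: GL_support_def)
      hence "?s \<nu> * GL_p0 \<nu> \<le> ?s \<nu> * z" using s by (intro mult_left_mono) auto
      also have "\<dots> < y" using z(2) s by (simp add: less_divide_eq mult.commute del: of_nat_mult)
      finally show ?case using y by simp
    qed
  qed
qed

lemma sigma_GL_p0_tendsto: "(\<lambda>\<nu>. sigma (GL_p0 \<nu>) / real (2 * \<nu>)) \<longlonglongrightarrow> 1 / j1"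
proof -
  define y where "y = (\<lambda>\<nu>. real (\<nu> * (\<nu> + 1)) * GL_p0 \<nu>)"
  have y: "y \<longlonglongrightarrow> (j1 / 2)\<^sup>2" unfolding y_def by (rule GL_p0_scaled_tendsto)
  have inv: "(\<lambda>n. inverse (real n)) \<longlonglongrightarrow> 0" by (rule lim_inverse_n)
  \<comment> \<open>The squared quotient is expressed through \<open>y\<close> and reciprocals of
    \<nu> and \<nu> + 1, all of which have limits, by substituting y / (\<nu>(\<nu> + 1)) for the
    node.\<close>
  have "(\<lambda>\<nu>. sqrt ((1 - y \<nu> * inverse (real \<nu>) * inverse (real (Suc \<nu>))) *
      (1 + inverse (real \<nu>)) / (4 * y \<nu>)))
     \<longlonglongrightarrow> sqrt ((1 - (j1 / 2)\<^sup>2 * 0 * 0) * (1 + 0) / (4 * (j1 / 2)\<^sup>2))"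
    using j1_pos by (intro tendsto_intros y inv LIMSEQ_Suc[OF inv]) auto
  also have "sqrt ((1 - (j1 / 2)\<^sup>2 * 0 * 0) * (1 + 0) / (4 * (j1 / 2)\<^sup>2)) = 1 / j1"
    using j1_pos by (simp add: power_divide real_sqrt_divide)
  finally have lim: "(\<lambda>\<nu>. sqrt ((1 - y \<nu> * inverse (real \<nu>) * inverse (real (Suc \<nu>))) *
      (1 + inverse (real \<nu>)) / (4 * y \<nu>))) \<longlonglongrightarrow> 1 / j1" .
  show ?thesis
  proof (rule Lim_transform_eventually[OF lim])
    show "eventually (\<lambda>\<nu>. sqrt ((1 - y \<nu> * inverse (real \<nu>) * inverse (real (Suc \<nu>))) *
      (1 + inverse (real \<nu>)) / (4 * y \<nu>)) = sigma (GL_p0 \<nu>) / real (2 * \<nu>)) sequentially"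
      using eventually_gt_at_top[of 0]
    proof eventually_elim
      case (elim \<nu>)
      let ?p = "GL_p0 \<nu>"
      have p: "?p > 0" using GL_p0_in_support[OF elim] GL_support_subset[of \<nu>] by auto
      have a1: "y \<nu> * inverse (real \<nu>) * inverse (real (Suc \<nu>)) = ?p"
        using elim unfolding y_def Suc_eq_plus1[symmetric] of_nat_mult
        by (simp add: field_simps del: of_nat_Suc)
      have a2: "y \<nu> = (real \<nu>)\<^sup>2 * ?p * (1 + inverse (real \<nu>))"
        using elim by (simp add: y_def field_simps power2_eq_square)
      have a3: "1 + inverse (real \<nu>) \<noteq> 0" using elim by (simp add: field_simps)
      have "(1 - y \<nu> * inverse (real \<nu>) * inverse (real (Suc \<nu>))) * (1 + inverse (real \<nu>)) / (4 * y \<nu>)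
          = (1 - ?p) / ?p / (real (2 * \<nu>))\<^sup>2"
        unfolding a1 using a3 by (simp add: a2 power_mult_distrib)
      thus ?case using elim by (simp only: real_sqrt_divide sigma_def real_sqrt_abs)
    qed
  qed
qed

section \<open>The inverse of t * r t\<close>

lemma mult_r_fun: "t > 0 \<Longrightarrow> t * r_fun t = (exp t - 1 - t) / t"
  by (simp add: r_fun_def power2_eq_square)

text \<open>The derivative of (e^t - 1 - t) / t is (1 - (1 - t) e^t) / t^2, positive because 1 - t <
  e^(-t).\<close>

lemma mult_r_fun_strict_mono:
  assumes "0 < a" "a < b"
  shows "a * r_fun a < b * r_fun b"
proof -
  have "(exp a - 1 - a) / a < (exp b - 1 - b) / b"
  proof (rule DERIV_pos_imp_increasing[OF assms(2), where f = "\<lambda>t. (exp t - 1 - t) / t"])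
    fix t assume "a \<le> t" "t \<le> b"
    hence t: "t > 0" using assms by simp
    have "1 - t < exp (- t)" using exp_minus_greater[of t] t by simp
    hence "(1 - t) * exp t < exp (- t) * exp t" by (intro mult_strict_right_mono) auto
    hence "0 < ((exp t - 1) * t - (exp t - 1 - t) * 1) / (t * t)"
      using t by (intro divide_pos_pos) (auto simp: algebra_simps simp flip: exp_add)
    moreover have "((\<lambda>t. (exp t - 1 - t) / t) has_real_derivative
        ((exp t - 1) * t - (exp t - 1 - t) * 1) / (t * t)) (at t)"
      using t by (auto intro!: derivative_eq_intros)
    ultimately show "\<exists>y. ((\<lambda>t. (exp t - 1 - t) / t) has_real_derivative y) (at t) \<and> 0 < y" by blast
  qed
  thus ?thesis using assms by (simp add: mult_r_fun)
qed

lemma mult_r_fun_surj: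
  assumes "y > 0"
  shows "\<exists>x>0. x * r_fun x = y"
proof -
  \<comment> \<open>The endpoints come from t/2 \<le> (e^t - 1 - t) / t for t > 0 and (e^t - 1 - t)
    / t \<le> t for 0 < t \<le> 1.\<close>
  let ?a = "min 1 y" and ?b = "2 * y"
  have "(exp ?a - 1 - ?a) / ?a \<le> ?a\<^sup>2 / ?a"
    using exp_bound[of ?a] assms by (intro divide_right_mono) auto
  also have "\<dots> \<le> y" by (simp add: power2_eq_square)
  finally have a: "(exp ?a - 1 - ?a) / ?a \<le> y" .
  have "?b\<^sup>2 / 2 / ?b \<le> (exp ?b - 1 - ?b) / ?b"
    using exp_lower_Taylor_quadratic[of ?b] assms by (intro divide_right_mono) auto
  hence b: "y \<le> (exp ?b - 1 - ?b) / ?b" using assms by (simp add: power2_eq_square)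
  have "\<exists>x\<ge>?a. x \<le> ?b \<and> (exp x - 1 - x) / x = y"
    using a b assms by (intro IVT') (auto intro!: continuous_intros)
  then obtain x where "?a \<le> x" "(exp x - 1 - x) / x = y" by blast
  moreover from this have "x > 0" using assms by linarith
  ultimately show ?thesis using mult_r_fun by auto
qed

lemma r_inv_pos: "y > 0 \<Longrightarrow> r_inv y > 0"
  and mult_r_fun_r_inv: "y > 0 \<Longrightarrow> r_inv y * r_fun (r_inv y) = y"
proof -
  assume "y > 0"
  have "\<exists>!x. x > 0 \<and> x * r_fun x = y"
    using mult_r_fun_surj[OF \<open>y > 0\<close>] mult_r_fun_strict_mono
    by (metis less_irrefl linorder_neqE_linordered_idom)
  from theI'[OF this] show "r_inv y > 0" "r_inv y * r_fun (r_inv y) = y"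
    unfolding r_inv_def by auto
qed

lemma less_r_inv_iff:
  assumes "a > 0" "y > 0"
  shows "a < r_inv y \<longleftrightarrow> a * r_fun a < y"
  using mult_r_fun_strict_mono[of a "r_inv y"] mult_r_fun_strict_mono[of "r_inv y" a]
    r_inv_pos[OF assms(2)] mult_r_fun_r_inv[OF assms(2)] assms
  by (metis less_asym linorder_neqE_linordered_idom)

lemma r_inv_less_iff:
  assumes "a > 0" "y > 0"
  shows "r_inv y < a \<longleftrightarrow> y < a * r_fun a"
  using mult_r_fun_strict_mono[of a "r_inv y"] mult_r_fun_strict_mono[of "r_inv y" a]
    r_inv_pos[OF assms(2)] mult_r_fun_r_inv[OF assms(2)] assms
  by (metis less_asym linorder_neqE_linordered_idom)

text \<open>Monotone inversion turns each order bound on \<open>r_inv (f n)\<close> into one on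
  \<open>f n\<close>; nonpositive lower bounds hold by positivity of \<open>r_inv\<close>.\<close>

lemma tendsto_r_inv:
  assumes "(f \<longlongrightarrow> y) F" "y > 0"
  shows "((\<lambda>n. r_inv (f n)) \<longlongrightarrow> r_inv y) F"
proof (rule order_tendstoI)
  have pos: "eventually (\<lambda>n. f n > 0) F" using order_tendstoD(1)[OF assms] .
  fix a
  {
    assume a: "a < r_inv y"
    show "eventually (\<lambda>n. a < r_inv (f n)) F"
    proof (cases "a > 0")
      case True
      hence "a * r_fun a < y" using a assms less_r_inv_iff by blast
      from order_tendstoD(1)[OF assms(1) this] pos show ?thesis
        by eventually_elim (use True in \<open>simp add: less_r_inv_iff\<close>)
    next
      case False
      from pos show ?thesis
        by eventually_elim (use False r_inv_pos in fastforce)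
    qed
  next
    assume a: "a > r_inv y"
    hence a0: "a > 0" using r_inv_pos[OF assms(2)] by simp
    hence "y < a * r_fun a" using a assms r_inv_less_iff by blast
    from order_tendstoD(2)[OF assms(1) this] pos show "eventually (\<lambda>n. r_inv (f n) < a) F"
      by eventually_elim (use a0 in \<open>simp add: r_inv_less_iff\<close>)
  }
qed

lemma filterlim_r_inv_at_top:
  assumes "filterlim f at_top F"
  shows "filterlim (\<lambda>n. r_inv (f n)) at_top F"
  unfolding filterlim_at_top_gt[where c = 0]
proof (intro allI impI)
  fix Z :: real assume Z: "0 < Z"
  from assms have "eventually (\<lambda>n. max 0 (Z * r_fun Z) < f n) F"
    unfolding filterlim_at_top_dense by blast
  thus "eventually (\<lambda>n. Z \<le> r_inv (f n)) F"
    by eventually_elim (use Z in \<open>simp add: less_imp_le less_r_inv_iff\<close>)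
qed

section \<open>Asymptotics of the code length\<close>

lemma f_lx_eq_pderiv:
  assumes "0 < p" "p < 1" "x \<le> l"
  shows "f_lx l x p = sqrt (p * (1 - p)) * poly (pderiv ([:0, 1:] ^ x * [:1, -1:] ^ (l - x))) p"
proof -
  \<comment> \<open>This form takes the same square root out of \<open>sigma p\<close> and
    \<open>sigma (1 - p)\<close>; the remaining bracket x/p - (l - x)/(1 - p) is a logarithmic
    derivative.\<close>
  have sigma: "sigma q = sqrt (q * (1 - q)) / q" if "0 < q" for q
  proof -
    have "(1 - q) / q = q * (1 - q) / q\<^sup>2" using that by (simp add: power2_eq_square)
    thus ?thesis unfolding sigma_def using that by (simp add: real_sqrt_divide)
  qed
  have s1: "sigma p = sqrt (p * (1 - p)) / p" using sigma[of p] assms by simp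
  have s2: "sigma (1 - p) = sqrt (p * (1 - p)) / (1 - p)"
    using sigma[of "1 - p"] assms by (simp add: mult.commute)
  have d1: "poly (pderiv ([:0, 1:] ^ n)) p = real n * p ^ n / p" for n
    using assms by (cases n) (simp_all add: pderiv_power_Suc pderiv_pCons poly_power del: power_Suc, simp)
  have d2: "poly (pderiv ([:1, -1:] ^ n)) p = - (real n * (1 - p) ^ n / (1 - p))" for n
    using assms by (cases n) (simp_all add: pderiv_power_Suc pderiv_pCons poly_power del: power_Suc, simp, simp add: algebra_simps)
  have d: "poly (pderiv ([:0, 1:] ^ x * [:1, -1:] ^ (l - x))) p =
      p ^ x * (1 - p) ^ (l - x) * (real x / p - real (l - x) / (1 - p))"
    unfolding pderiv_mult poly_add poly_mult d1 d2 by (simp add: poly_power algebra_simps)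
  show ?thesis unfolding f_lx_def s1 s2 d by (simp add: right_diff_distrib mult_ac)
qed

text \<open>The constant \<open>K\<close> relating the two families of weights is common to all
  nodes and cancels on normalisation.\<close>

lemma GL_prob_eq:
  assumes "p \<in> GL_support \<nu>"
  shows "GL_prob \<nu> p = quad_weight \<nu> p * inverse (sqrt (p * (1 - p))) / GL_singular_sum \<nu>"
proof -
  define K where "K = (2 * real \<nu> + 1) * unit_integral (GL_poly \<nu> * GL_poly \<nu>)"
  have K: "K > 0" unfolding K_def by (intro mult_pos_pos unit_integral_square_pos) auto
  have w: "quad_weight \<nu> p * inverse (sqrt (p * (1 - p))) = K * GL_weight \<nu> p"
    if "p \<in> GL_support \<nu>" for p
  proof -
    have "p * (1 - p) > 0" using GL_support_subset[of \<nu>] that by auto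
    hence powr: "(p * (1 - p)) powr (3 / 2) = p * (1 - p) * sqrt (p * (1 - p))"
      using powr_add[of "p * (1 - p)" 1 "1 / 2"] by (simp add: powr_half_sqrt)
    have "K / (q * r) * inverse (sqrt q) = K * inverse (q * sqrt q * r)" for q r
      by (simp add: divide_inverse mult_ac)
    thus ?thesis
      unfolding quad_weight_closed_form[OF that] GL_weight_def K_def[symmetric] powr .
  qed
  have "GL_singular_sum \<nu> = K * (\<Sum>q\<in>GL_support \<nu>. GL_weight \<nu> q)"
    unfolding GL_singular_sum_def sum_distrib_left by (intro sum.cong w refl)
  thus ?thesis unfolding w[OF assms] GL_prob_def using K by simp
qed

text \<open>The square roots cancel, leaving the quadrature of a derivative of degree at most l - 1
  < 2\<nu>, hence exactly a difference of endpoint values.\<close>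

lemma GL_E_f_lx:
  assumes "x \<le> l" "1 \<le> l" "l \<le> 2 * \<nu>"
  shows "GL_E \<nu> (f_lx l x) = ((if x = l then 1 else 0) - (if x = 0 then 1 else 0)) / GL_singular_sum \<nu>"
proof -
  let ?g = "[:0, 1 :: real:] ^ x * [:1, -1:] ^ (l - x)"
  have "degree (pderiv ?g) < 2 * \<nu>"
  proof -
    have "degree ?g \<le> x + (l - x)"
      by (intro order.trans[OF degree_mult_le] add_mono order.trans[OF degree_power_le]) auto
    thus ?thesis using assms by (simp add: degree_pderiv)
  qed
  from Gauss_quadrature[OF this]
  have quad: "(\<Sum>p\<in>GL_support \<nu>. quad_weight \<nu> p * poly (pderiv ?g) p) = poly ?g 1 - poly ?g 0"
    by (simp add: unit_integral_pderiv)
  have "GL_E \<nu> (f_lx l x) =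
      (\<Sum>p\<in>GL_support \<nu>. quad_weight \<nu> p * poly (pderiv ?g) p / GL_singular_sum \<nu>)"
    unfolding GL_E_def
  proof (intro sum.cong refl)
    fix p assume p: "p \<in> GL_support \<nu>"
    hence "0 < p" "p < 1" using GL_support_subset[of \<nu>] by auto
    hence "sqrt (p * (1 - p)) \<noteq> 0" by simp
    thus "GL_prob \<nu> p * f_lx l x p = quad_weight \<nu> p * poly (pderiv ?g) p / GL_singular_sum \<nu>"
      unfolding GL_prob_eq[OF p] f_lx_eq_pderiv[OF \<open>0 < p\<close> \<open>p < 1\<close> assms(1)] by simp
  qed
  also have "\<dots> = (poly ?g 1 - poly ?g 0) / GL_singular_sum \<nu>"
    unfolding quad[symmetric] sum_divide_distrib ..
  also have "poly ?g 1 = (if x = l then 1 else 0)" using assms by (auto simp: poly_power)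
  also have "poly ?g 0 = (if x = 0 then 1 else 0)" by (auto simp: poly_power)
  finally show ?thesis .
qed

text \<open>For 0 < x < l both endpoint values vanish, so only the term with x = 0
  contributes.\<close>

lemma calR_GL:
  assumes "1 \<le> l" "l \<le> 2 * \<nu>"
  shows "calR (GL_E \<nu>) l = 1 / GL_singular_sum \<nu>"
proof -
  have "GL_E \<nu> (f_lx l x) = 0" if "x \<in> {1..l - 1}" for x
    using that assms by (subst GL_E_f_lx) auto
  hence "(\<Sum>x = 1..l - 1. real (l choose x) * R_lx (GL_E \<nu>) l x) = 0"
    by (intro sum.neutral) (auto simp: R_lx_def)
  moreover have "GL_E \<nu> (\<lambda>p. - f_lx l 0 p) = - GL_E \<nu> (f_lx l 0)"
    by (simp add: GL_E_def sum_negf)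
  ultimately show ?thesis using assms by (simp add: calR_def GL_E_f_lx)
qed

lemma calR_min_GL:
  assumes "\<nu> \<ge> 1"
  shows "calR_min \<nu> = 1 / GL_singular_sum \<nu>"
proof -
  have "(\<lambda>l. calR (GL_E \<nu>) l) ` {1..2 * \<nu>} = {1 / GL_singular_sum \<nu>}"
    using assms by (auto simp: calR_GL intro!: image_eqI[of _ _ 1])
  thus ?thesis by (simp add: calR_min_def)
qed

lemma calR_min_tendsto: "calR_min \<longlonglongrightarrow> 1 / pi"
proof (rule Lim_transform_eventually)
  show "(\<lambda>\<nu>. 1 / GL_singular_sum \<nu>) \<longlonglongrightarrow> 1 / pi"
    by (intro tendsto_divide tendsto_const GL_singular_sum_tendsto) simp
  show "eventually (\<lambda>\<nu>. 1 / GL_singular_sum \<nu> = calR_min \<nu>) sequentially"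
    using eventually_ge_at_top[of 1] by eventually_elim (simp add: calR_min_GL)
qed

theorem theorem5:
  fixes \<eta>1 \<eta>2 \<epsilon>1 \<epsilon>2 :: "nat \<Rightarrow> real" and \<eta> \<eta>' :: real
  assumes "\<And>\<nu>. \<nu> \<ge> 1 \<Longrightarrow> \<eta>1 \<nu> > 0"
    and "\<And>\<nu>. \<nu> \<ge> 1 \<Longrightarrow> \<eta>2 \<nu> > 0"
    and "\<And>\<nu>. \<nu> \<ge> 1 \<Longrightarrow> 0 < \<epsilon>1 \<nu> \<and> \<epsilon>1 \<nu> < 1"
    and "\<And>\<nu>. \<nu> \<ge> 1 \<Longrightarrow> 0 < \<epsilon>2 \<nu> \<and> \<epsilon>2 \<nu> < 1"
    and "\<eta> > 0" and "\<eta>1 \<longlonglongrightarrow> \<eta>"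
    and "filterlim \<eta>2 at_top sequentially"
    and "\<eta>' \<ge> 0" and "(\<lambda>\<nu>. \<eta>2 \<nu> / real (2 * \<nu>)) \<longlonglongrightarrow> \<eta>'"
    and "\<eta> + \<eta>' < 1"
    and "\<exists>B. \<forall>\<^sub>F \<nu> in sequentially. \<bar>ln (1 / \<epsilon>2 \<nu>) / ln (1 / \<epsilon>1 \<nu>)\<bar> \<le> B"
  shows "(\<lambda>\<nu>. m_GL \<eta>1 \<eta>2 \<epsilon>1 \<epsilon>2 \<nu> /
            (pi / ((1 - \<eta> - \<eta>') * j1 * r_inv (\<eta> / (pi * j1)))
              * (real (2 * \<nu>))\<^sup>2 * ln (1 / \<epsilon>1 \<nu>))) \<longlonglongrightarrow> 1"
proof -
  define xlim where "xlim = r_inv (\<eta> / (pi * j1))"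
  define K where "K = pi / ((1 - \<eta> - \<eta>') * j1 * xlim)"
  define \<psi> where "\<psi> = (\<lambda>\<nu>. sigma (GL_p0 \<nu>))"
  define c where "c = (\<lambda>\<nu>. real (2 * \<nu>))"
  define x1 where "x1 = (\<lambda>\<nu>. r_inv (\<eta>1 \<nu> * calR_min \<nu> * \<psi> \<nu> / c \<nu>))"
  define x2 where "x2 = (\<lambda>\<nu>. r_inv (\<eta>2 \<nu> * calR_min \<nu> * \<psi> \<nu> / c \<nu>))"
  define \<rho> where "\<rho> = (\<lambda>\<nu>. ln (1 / \<epsilon>2 \<nu>) / ln (1 / \<epsilon>1 \<nu>))"
  \<comment> \<open>The factor common to both summands: dividing \<open>A_i\<close> by the claimed
    asymptotic expression leaves \<open>D\<close> times \<open>1 / x1\<close> or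
    \<open>1 / x2 * \<rho>\<close>.\<close>
  define D where "D = (\<lambda>\<nu>. (\<psi> \<nu> / c \<nu>) / ((1 - \<eta>1 \<nu> - \<eta>2 \<nu> / c \<nu>) * calR_min \<nu> * K))"
  have ylim: "\<eta> / (pi * j1) > 0" using assms(5) j1_pos by simp
  hence xlim: "xlim > 0" unfolding xlim_def by (rule r_inv_pos)
  have \<psi>: "(\<lambda>\<nu>. \<psi> \<nu> / c \<nu>) \<longlonglongrightarrow> 1 / j1"
    unfolding \<psi>_def c_def by (rule sigma_GL_p0_tendsto)
  have \<eta>2: "(\<lambda>\<nu>. \<eta>2 \<nu> / c \<nu>) \<longlonglongrightarrow> \<eta>'" unfolding c_def by (rule assms(9))
  note lims = \<psi> calR_min_tendsto assms(6) \<eta>2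
  have "(\<lambda>\<nu>. \<eta>1 \<nu> * calR_min \<nu> * (\<psi> \<nu> / c \<nu>)) \<longlonglongrightarrow> \<eta> * (1 / pi) * (1 / j1)"
    by (intro tendsto_mult lims)
  hence x1: "x1 \<longlonglongrightarrow> xlim"
    unfolding x1_def xlim_def using ylim by (intro tendsto_r_inv) auto
  \<comment> \<open>The argument of \<open>r_inv\<close> in \<open>x2\<close> is
    \<open>\<eta>2\<close> times a quantity with positive limit 1 / (pi j1), hence unbounded even
    when \<open>\<eta>2 / c\<close> tends to 0.\<close>
  have "filterlim (\<lambda>\<nu>. (calR_min \<nu> * (\<psi> \<nu> / c \<nu>)) * \<eta>2 \<nu>) at_top sequentially"
    by (rule filterlim_tendsto_pos_mult_at_top[OF tendsto_mult[OF lims(2,1)] _ assms(7)])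
       (use j1_pos in simp)
  hence x2: "filterlim x2 at_top sequentially"
    unfolding x2_def by (intro filterlim_r_inv_at_top) (simp add: mult_ac)
  obtain B where B: "eventually (\<lambda>\<nu>. \<bar>\<rho> \<nu>\<bar> \<le> B) sequentially"
    using assms(11) unfolding \<rho>_def by blast
  have inv_x2: "(\<lambda>\<nu>. 1 / x2 \<nu>) \<longlonglongrightarrow> 0"
    by (rule real_tendsto_divide_at_top[OF tendsto_const x2])
  have small: "(\<lambda>\<nu>. 1 / x2 \<nu> * \<rho> \<nu>) \<longlonglongrightarrow> 0"
  proof (rule Lim_null_comparison)
    show "(\<lambda>\<nu>. \<bar>1 / x2 \<nu>\<bar> * B) \<longlonglongrightarrow> 0"
      by (intro tendsto_mult_left_zero tendsto_rabs_zero inv_x2)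
    show "eventually (\<lambda>\<nu>. norm (1 / x2 \<nu> * \<rho> \<nu>) \<le> \<bar>1 / x2 \<nu>\<bar> * B) sequentially"
      using B by eventually_elim (simp only: real_norm_def abs_mult mult_left_mono abs_ge_zero)
  qed
  have K: "K > 0" unfolding K_def using assms(10) xlim j1_pos by simp
  have D: "D \<longlonglongrightarrow> (1 / j1) / ((1 - \<eta> - \<eta>') * (1 / pi) * K)"
    unfolding D_def by (intro lims tendsto_divide tendsto_mult tendsto_diff tendsto_const) (use K assms(10) in auto)
  also have "(1 / j1) / ((1 - \<eta> - \<eta>') * (1 / pi) * K) = xlim"
  proof -
    have "1 - \<eta> - \<eta>' \<noteq> 0" using assms(10) by simp
    thus ?thesis unfolding K_def using xlim j1_pos by simp
  qed
  finally have D: "D \<longlonglongrightarrow> xlim" .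
  have "(\<lambda>\<nu>. D \<nu> * (1 / x1 \<nu> + 1 / x2 \<nu> * \<rho> \<nu>)) \<longlonglongrightarrow> xlim * (1 / xlim + 0)"
    by (intro tendsto_mult tendsto_add D small tendsto_divide tendsto_const x1) (use xlim in simp)
  hence lim: "(\<lambda>\<nu>. D \<nu> * (1 / x1 \<nu> + 1 / x2 \<nu> * \<rho> \<nu>)) \<longlonglongrightarrow> 1" using xlim by simp
  show ?thesis
    unfolding xlim_def[symmetric] K_def[symmetric]
  proof (rule Lim_transform_eventually[OF lim])
    show "eventually (\<lambda>\<nu>. D \<nu> * (1 / x1 \<nu> + 1 / x2 \<nu> * \<rho> \<nu>) =
        m_GL \<eta>1 \<eta>2 \<epsilon>1 \<epsilon>2 \<nu> / (K * (real (2 * \<nu>))\<^sup>2 * ln (1 / \<epsilon>1 \<nu>))) sequentially"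
      \<comment> \<open>The identity is exact once c and log(1/\<epsilon>1) are nonzero, which \<nu>
        \<ge> 1 ensures.\<close>
      using eventually_ge_at_top[of 1]
    proof eventually_elim
      case (elim \<nu>)
      have l1: "ln (1 / \<epsilon>1 \<nu>) \<noteq> 0" using assms(3)[OF elim] by (simp add: ln_div)
      have c0: "c \<nu> \<noteq> 0" using elim by (simp add: c_def)
      have alg: "c \<nu> / (d * R) * (P / x) * l / (K * (c \<nu>)\<^sup>2 * l1) = (P / c \<nu>) / (d * R * K) * (1 / x * (l / l1))"
        for d R P x l l1 :: real using c0 by (simp add: power2_eq_square)
      have A1: "A_i \<eta>1 \<eta>2 (\<eta>1 \<nu>) (\<epsilon>1 \<nu>) \<nu> =
          c \<nu> / ((1 - \<eta>1 \<nu> - \<eta>2 \<nu> / c \<nu>) * calR_min \<nu>) * (\<psi> \<nu> / x1 \<nu>) * ln (1 / \<epsilon>1 \<nu>)"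
        by (simp only: A_i_def Let_def c_def \<psi>_def x1_def)
      have A2: "A_i \<eta>1 \<eta>2 (\<eta>2 \<nu>) (\<epsilon>2 \<nu>) \<nu> =
          c \<nu> / ((1 - \<eta>1 \<nu> - \<eta>2 \<nu> / c \<nu>) * calR_min \<nu>) * (\<psi> \<nu> / x2 \<nu>) * ln (1 / \<epsilon>2 \<nu>)"
        by (simp only: A_i_def Let_def c_def \<psi>_def x2_def)
      have c: "real (2 * \<nu>) = c \<nu>" by (simp add: c_def)
      show ?case
        unfolding m_GL_def A1 A2 c add_divide_distrib alg
        using l1 by (simp add: D_def \<rho>_def distrib_left)
    qed
  qed
qed

end
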